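(* For a space $X$, the following are equivalent: (a) $X$ is countably paracompact and normal. (b) If $\Phi:X\to\mathscr{F}_{\mathbf c}(\mathbb{J}(2))$ is l.s.c., $\theta:X\to\mathscr{C}(\mathbb{J}(2))$ is u.s.c. and $\theta<\Phi$, then there exists a continuous mapping $\varphi:X\to\mathscr{C}_{\mathbf c}(\mathbb{J}(2))$ such that $\theta<\varphi\leqslant\Phi$. (c) If $\xi:X\to\mathbb{R}$ is upper semicontinuous, $\eta:X\to\mathbb{R}$ is lower semicontinuous and $\xi<\eta$, then there exists a continuous function $f:X\to\mathbb{R}$ such that $\xi<f<\eta$.
   Context: All spaces are infinite Hausdorff topological spaces. For a set $Y$, $2^Y$ denotes the family of all nonempty subsets of $Y$. For a space $Y$: $\mathscr{F}(Y)$ and $\mathscr{C}(Y)$ are the families of all nonempty closed, respectively nonempty compact, subsets of $Y$; $\mathscr{F}_{\mathbf c}(Y)$ and $\mathscr{C}_{\mathbf c}(Y)$ are the families of their connected members. A mapping $\Phi:X\to 2^Y$ is l.s.c. if $\{x\in X:\Phi(x)\cap U\neq\varnothing\}$ is open for every open $U\subseteq Y$; u.s.c. if $\{x\in X:\Phi(x)\cap F\neq\varnothing\}$ is closed for every closed $F\subseteq Y$; continuous if it is both. For $\theta,\Phi:X\to 2^Y$, $\theta\leqslant\Phi$ means $\theta(x)\subseteq\Phi(x)$ for all $x\in X$; $\theta<\Phi$ means $\theta\leqslant\Phi$ and $\Phi(x)\setminus\theta(x)\neq\varnothing$ for all $x\in X$. $\mathbb{J}(2)$ is the metrizable hedgehog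 with two spines: for a two-point set $\mathscr{A}$, it is the set $\{0\}\cup(0,1]\times\mathscr{A}$ with the metric $d(0,\langle s,\alpha\rangle)=s$, $d(\langle s,\alpha\rangle,\langle t,\beta\rangle)=|s-t|$ if $\alpha=\beta$, and $=s+t$ if $\alpha\neq\beta$. It is isometric to $[-1,1]$ with the Euclidean distance. A function $\xi:X\to\mathbb{R}$ is lower (upper) semicontinuous if $\{x\in X:\xi(x)>r\}$ (respectively $\{x\in X:\xi(x)<r\}$) is open in $X$ for every $r\in\mathbb{R}$. For functions $\xi,\eta:X\to\mathbb{R}$, $\xi<\eta$ means $\xi(x)<\eta(x)$ for every $x\in X$. *)

theory Defs
  imports "HOL-Analysis.Analysis"
begin

section \<open>Countable paracompactness\<close>

definition open_cover :: "'a topology \<Rightarrow> 'a set set \<Rightarrow> bool" where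
  "open_cover X \<U> \<longleftrightarrow> (\<forall>U\<in>\<U>. openin X U) \<and> \<Union>\<U> = topspace X"

definition refines :: "'a set set \<Rightarrow> 'a set set \<Rightarrow> bool" where
  "refines \<V> \<U> \<longleftrightarrow> (\<forall>V\<in>\<V>. \<exists>U\<in>\<U>. V \<subseteq> U)"

definition countably_paracompact_space :: "'a topology \<Rightarrow> bool" where
  "countably_paracompact_space X \<longleftrightarrow>
     (\<forall>\<U>. countable \<U> \<and> open_cover X \<U> \<longrightarrow>
        (\<exists>\<V>. open_cover X \<V> \<and> refines \<V> \<U> \<and> locally_finite_in X \<V>))"

section \<open>Set-valued mappings\<close>

definition nonempty_closed_sets :: "'b topology \<Rightarrow> 'b set set" where
  "nonempty_closed_sets Y = {S. closedin Y S \<and> S \<noteq> {}}"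

definition nonempty_compact_sets :: "'b topology \<Rightarrow> 'b set set" where
  "nonempty_compact_sets Y = {S. compactin Y S \<and> S \<noteq> {}}"

definition nonempty_closed_connected_sets :: "'b topology \<Rightarrow> 'b set set" where
  "nonempty_closed_connected_sets Y = {S \<in> nonempty_closed_sets Y. connectedin Y S}"

definition nonempty_compact_connected_sets :: "'b topology \<Rightarrow> 'b set set" where
  "nonempty_compact_connected_sets Y = {S \<in> nonempty_compact_sets Y. connectedin Y S}"

definition lsc_map :: "'a topology \<Rightarrow> 'b topology \<Rightarrow> ('a \<Rightarrow> 'b set) \<Rightarrow> bool" where
  "lsc_map X Y \<Phi> \<longleftrightarrow> (\<forall>U. openin Y U \<longrightarrow> openin X {x \<in> topspace X. \<Phi> x \<inter> U \<noteq> {}})"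

definition usc_map :: "'a topology \<Rightarrow> 'b topology \<Rightarrow> ('a \<Rightarrow> 'b set) \<Rightarrow> bool" where
  "usc_map X Y \<Phi> \<longleftrightarrow> (\<forall>F. closedin Y F \<longrightarrow> closedin X {x \<in> topspace X. \<Phi> x \<inter> F \<noteq> {}})"

definition continuous_set_map :: "'a topology \<Rightarrow> 'b topology \<Rightarrow> ('a \<Rightarrow> 'b set) \<Rightarrow> bool" where
  "continuous_set_map X Y \<Phi> \<longleftrightarrow> lsc_map X Y \<Phi> \<and> usc_map X Y \<Phi>"

definition set_map_le :: "'a topology \<Rightarrow> ('a \<Rightarrow> 'b set) \<Rightarrow> ('a \<Rightarrow> 'b set) \<Rightarrow> bool" where
  "set_map_le X \<theta> \<Phi> \<longleftrightarrow> (\<forall>x\<in>topspace X. \<theta> x \<subseteq> \<Phi> x)"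

definition set_map_less :: "'a topology \<Rightarrow> ('a \<Rightarrow> 'b set) \<Rightarrow> ('a \<Rightarrow> 'b set) \<Rightarrow> bool" where
  "set_map_less X \<theta> \<Phi> \<longleftrightarrow> set_map_le X \<theta> \<Phi> \<and> (\<forall>x\<in>topspace X. \<Phi> x - \<theta> x \<noteq> {})"

section \<open>Semicontinuous real functions\<close>

definition lower_semicontinuous_real :: "'a topology \<Rightarrow> ('a \<Rightarrow> real) \<Rightarrow> bool" where
  "lower_semicontinuous_real X \<xi> \<longleftrightarrow> (\<forall>r. openin X {x \<in> topspace X. \<xi> x > r})"

definition upper_semicontinuous_real :: "'a topology \<Rightarrow> ('a \<Rightarrow> real) \<Rightarrow> bool" where
  "upper_semicontinuous_real X \<xi> \<longleftrightarrow> (\<forall>r. openin X {x \<in> topspace X. \<xi> x < r})"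

section \<open>The metrizable hedgehog\<close>

text \<open>
  The hedgehog is the carrier below, not the whole datatype, whose \<open>Spine s \<alpha>\<close> also allows
  \<open>s\<close> outside \<open>(0,1]\<close>. The absolute values have no effect on the carrier; they are there
  because the locale \<^locale>\<open>Metric_space\<close> requires nonnegativity on the whole type.
\<close>

datatype 'b hedgehog_point = Origin | Spine real 'b

definition hedgehog :: "'b set \<Rightarrow> 'b hedgehog_point set" where
  "hedgehog A = {Origin} \<union> {Spine s \<alpha> | s \<alpha>. 0 < s \<and> s \<le> 1 \<and> \<alpha> \<in> A}"

fun hedgehog_dist :: "'b hedgehog_point \<Rightarrow> 'b hedgehog_point \<Rightarrow> real" where
  "hedgehog_dist Origin Origin = 0"
| "hedgehog_dist Origin (Spine s \<alpha>) = \<bar>s\<bar>"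
| "hedgehog_dist (Spine s \<alpha>) Origin = \<bar>s\<bar>"
| "hedgehog_dist (Spine s \<alpha>) (Spine t \<beta>) = (if \<alpha> = \<beta> then \<bar>s - t\<bar> else \<bar>s\<bar> + \<bar>t\<bar>)"

lemma Metric_space_hedgehog: "Metric_space (hedgehog A) hedgehog_dist"
proof
  fix x y z :: "'a hedgehog_point"
  show "0 \<le> hedgehog_dist x y"
    by (cases x; cases y) auto
  show "hedgehog_dist x y = hedgehog_dist y x"
    by (cases x; cases y) auto
  show "hedgehog_dist x y = 0 \<longleftrightarrow> x = y" if "x \<in> hedgehog A" "y \<in> hedgehog A"
    using that by (cases x; cases y) (auto simp: hedgehog_def)
  show "hedgehog_dist x z \<le> hedgehog_dist x y + hedgehog_dist y z"
    by (cases x; cases y; cases z) (auto split: if_splits)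
qed

definition hedgehog_topology :: "'b set \<Rightarrow> 'b hedgehog_point topology" where
  "hedgehog_topology A = Metric_space.mtopology (hedgehog A) hedgehog_dist"

lemma topspace_hedgehog_topology [simp]: "topspace (hedgehog_topology A) = hedgehog A"
  by (simp add: hedgehog_topology_def Metric_space.topspace_mtopology Metric_space_hedgehog)

lemma hedgehog_two_isometric:
  assumes "\<alpha> \<noteq> \<beta>"
  obtains h where "bij_betw h (hedgehog {\<alpha>, \<beta>}) {-1..1::real}"
    "\<And>x y. \<lbrakk>x \<in> hedgehog {\<alpha>, \<beta>}; y \<in> hedgehog {\<alpha>, \<beta>}\<rbrakk> \<Longrightarrow> \<bar>h x - h y\<bar> = hedgehog_dist x y"
proof
  define h where "h = (\<lambda>x. case x of Origin \<Rightarrow> 0 | Spine s \<gamma> \<Rightarrow> if \<gamma> = \<alpha> then s else - s)"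
  show iso: "\<bar>h x - h y\<bar> = hedgehog_dist x y"
    if "x \<in> hedgehog {\<alpha>, \<beta>}" "y \<in> hedgehog {\<alpha>, \<beta>}" for x y
    using that assms by (auto simp: h_def hedgehog_def)
  show "bij_betw h (hedgehog {\<alpha>, \<beta>}) {-1..1}"
    unfolding bij_betw_def
  proof
    show "inj_on h (hedgehog {\<alpha>, \<beta>})"
      using assms by (auto simp: inj_on_def h_def hedgehog_def)
    show "h ` hedgehog {\<alpha>, \<beta>} = {-1..1}"
    proof
      show "h ` hedgehog {\<alpha>, \<beta>} \<subseteq> {-1..1}"
        by (auto simp: h_def hedgehog_def)
      show "{-1..1} \<subseteq> h ` hedgehog {\<alpha>, \<beta>}"
      proof
        fix t :: real assume t: "t \<in> {-1..1}"
        consider "t = 0" | "t > 0" | "t < 0" by linarith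
        then show "t \<in> h ` hedgehog {\<alpha>, \<beta>}"
        proof cases
          case 1
          then show ?thesis by (intro image_eqI[of _ _ Origin]) (auto simp: h_def hedgehog_def)
        next
          case 2
          then show ?thesis using t
            by (intro image_eqI[of _ _ "Spine t \<alpha>"]) (auto simp: h_def hedgehog_def)
        next
          case 3
          then show ?thesis using t assms
            by (intro image_eqI[of _ _ "Spine (- t) \<beta>"]) (auto simp: h_def hedgehog_def)
        qed
      qed
    qed
  qed
qed

end

theory Submission
  imports Defs
begin

text \<open>
  The hedgehog is homeomorphic to a compact interval, so a closed connected value is \<open>[a, b]\<close> with
  \<open>a\<close> upper and \<open>b\<close> lower semicontinuous, and a compact value \<open>\<theta>(x)\<close> has a lower semicontinuous
  minimum \<open>p\<close> and an upper semicontinuous maximum \<open>q\<close>.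

  From (a) to (b): the open sets \<open>{x. a x < r < b x \<and> r \<notin> \<theta> x}\<close>, \<open>r\<close> rational, cover \<open>X\<close>; let \<open>F\<^sub>r\<close> be
  a locally finite closed shrinking. Lowering \<open>p\<close> to at most \<open>r\<close> and raising \<open>q\<close> to at least \<open>r\<close>
  on \<open>F\<^sub>r\<close> keeps both semicontinuous and within \<open>[a, b]\<close>. The Katetov-Tong theorem inserts \<open>g\<close>
  between \<open>a\<close> and the lowered \<open>p\<close>, and \<open>h\<close> between the raised \<open>q\<close> and \<open>b\<close>; then \<open>[g, h]\<close> contains
  \<open>\<theta>\<close> and, on each \<open>F\<^sub>r\<close>, the point \<open>r \<notin> \<theta>\<close>.

  From (b) to (c): expand \<open>[l, \<xi>]\<close> inside \<open>[l, \<eta>]\<close> to get \<open>h\<close> with \<open>\<xi> < h \<le> \<eta>\<close>, symmetrically a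
  \<open>k\<close> with \<open>\<xi> \<le> k < \<eta>\<close>, and average.

  From (c) to (a): insert between suitable combinations of indicator functions (normality), and
  between \<open>0\<close> and \<open>1 / (n(x) + 1)\<close>, where \<open>n(x)\<close> is the first index of a cover element containing \<open>x\<close>
  (countable paracompactness).
\<close>

section \<open>Elementary properties of semicontinuous real functions\<close>

lemma upper_semicontinuous_real_uminus [simp]:
  "upper_semicontinuous_real X (\<lambda>x. - f x) \<longleftrightarrow> lower_semicontinuous_real X f"
proof -
  have "(- f x < r) = (f x > - r)" for x r by linarith
  then show ?thesis
    unfolding upper_semicontinuous_real_def lower_semicontinuous_real_def
    by simp (metis minus_minus)
qed

lemma lower_semicontinuous_real_uminus [simp]:
  "lower_semicontinuous_real X (\<lambda>x. - f x) \<longleftrightarrow> upper_semicontinuous_real X f"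
  using upper_semicontinuous_real_uminus[of X "\<lambda>x. - f x"] by simp

lemma continuous_map_iff_semicontinuous:
  "continuous_map X euclideanreal f \<longleftrightarrow>
     lower_semicontinuous_real X f \<and> upper_semicontinuous_real X f"
  unfolding continuous_map_upper_lower_semicontinuous_lt
    lower_semicontinuous_real_def upper_semicontinuous_real_def by simp

lemma semicontinuous_real_const [simp]:
  "lower_semicontinuous_real X (\<lambda>x. c)" "upper_semicontinuous_real X (\<lambda>x. c)"
  using continuous_map_iff_semicontinuous[of X "\<lambda>x. c"] by auto

lemma upper_semicontinuous_real_max:
  assumes "upper_semicontinuous_real X f" "upper_semicontinuous_real X g"
  shows "upper_semicontinuous_real X (\<lambda>x. max (f x) (g x))"
proof -
  have "{x \<in> topspace X. max (f x) (g x) < r} =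
        {x \<in> topspace X. f x < r} \<inter> {x \<in> topspace X. g x < r}" for r
    by auto
  with assms show ?thesis unfolding upper_semicontinuous_real_def by auto
qed

lemma lower_semicontinuous_real_min:
  assumes "lower_semicontinuous_real X f" "lower_semicontinuous_real X g"
  shows "lower_semicontinuous_real X (\<lambda>x. min (f x) (g x))"
proof -
  have "{x \<in> topspace X. min (f x) (g x) > r} =
        {x \<in> topspace X. f x > r} \<inter> {x \<in> topspace X. g x > r}" for r
    by auto
  with assms show ?thesis unfolding lower_semicontinuous_real_def by auto
qed

lemma upper_semicontinuous_real_closedin:
  assumes "upper_semicontinuous_real X f"
  shows "closedin X {x \<in> topspace X. r \<le> f x}"
proof -
  have "{x \<in> topspace X. r \<le> f x} = topspace X - {x \<in> topspace X. f x < r}" by auto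
  with assms show ?thesis unfolding upper_semicontinuous_real_def by auto
qed

lemma lower_semicontinuous_real_closedin:
  assumes "lower_semicontinuous_real X f"
  shows "closedin X {x \<in> topspace X. f x \<le> r}"
proof -
  have "{x \<in> topspace X. f x \<le> r} = topspace X - {x \<in> topspace X. f x > r}" by auto
  with assms show ?thesis unfolding lower_semicontinuous_real_def by auto
qed

section \<open>The Katetov-Tong insertion theorem\<close>

text \<open>Quantize at the levels \<open>L + k * e\<close>. Because \<open>a \<le> b\<close>, the
  closed sets where \<open>b\<close> is at most level \<open>k\<close> and where \<open>a\<close>
  reaches level \<open>k + 1\<close> are disjoint, so Urysohn functions \<open>u k\<close> separate
  them. Adding steps of height \<open>e\<close> gives a continuous staircase that is off by at most
  one step.\<close>

lemma approximate_insertion: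
  fixes a b :: "'a \<Rightarrow> real"
  assumes X: "normal_space X"
    and a: "upper_semicontinuous_real X a" and b: "lower_semicontinuous_real X b"
    and ab: "\<And>x. x \<in> topspace X \<Longrightarrow> L \<le> a x \<and> a x \<le> b x \<and> a x \<le> M"
    and e: "e > 0"
  obtains f where "continuous_map X euclideanreal f"
    "\<And>x. x \<in> topspace X \<Longrightarrow> a x - e \<le> f x \<and> f x \<le> b x + e"
proof -
  have "\<exists>u. continuous_map X (top_of_set {0..1::real}) u \<and>
            (\<forall>x\<in>topspace X. (b x \<le> L + real k * e \<longrightarrow> u x = 0) \<and>
                             (L + real (Suc k) * e \<le> a x \<longrightarrow> u x = 1))" for k
  proof -
    have "disjnt {x \<in> topspace X. b x \<le> L + real k * e}
                 {x \<in> topspace X. L + real (Suc k) * e \<le> a x}"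
      using ab e by (force simp: disjnt_iff algebra_simps)
    then obtain u where "continuous_map X (top_of_set {0..1::real}) u"
      "u ` {x \<in> topspace X. b x \<le> L + real k * e} \<subseteq> {0}"
      "u ` {x \<in> topspace X. L + real (Suc k) * e \<le> a x} \<subseteq> {1}"
      by (rule Urysohn_lemma[OF X lower_semicontinuous_real_closedin[OF b]
            upper_semicontinuous_real_closedin[OF a] _ zero_le_one])
    then show ?thesis by (intro exI[of _ u]) (simp add: image_subset_iff)
  qed
  then have "\<exists>u. \<forall>k. continuous_map X (top_of_set {0..1::real}) (u k) \<and>
            (\<forall>x\<in>topspace X. (b x \<le> L + real k * e \<longrightarrow> u k x = 0) \<and>
                             (L + real (Suc k) * e \<le> a x \<longrightarrow> u k x = 1))"
    by (intro choice allI)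
  then obtain u where "\<forall>k. continuous_map X (top_of_set {0..1::real}) (u k) \<and>
            (\<forall>x\<in>topspace X. (b x \<le> L + real k * e \<longrightarrow> u k x = 0) \<and>
                             (L + real (Suc k) * e \<le> a x \<longrightarrow> u k x = 1))"
    by (elim exE)
  then have u: "\<And>k. continuous_map X (top_of_set {0..1::real}) (u k)"
    and u0: "\<And>k x. \<lbrakk>x \<in> topspace X; b x \<le> L + real k * e\<rbrakk> \<Longrightarrow> u k x = 0"
    and u1: "\<And>k x. \<lbrakk>x \<in> topspace X; L + real (Suc k) * e \<le> a x\<rbrakk> \<Longrightarrow> u k x = 1"
    by simp_all
  have u01: "0 \<le> u k x \<and> u k x \<le> 1" if "x \<in> topspace X" for k x
    using u[of k] that by (auto simp: continuous_map_in_subtopology)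
  \<comment> \<open>Enough steps to climb past every value of \<open>a\<close>; only the lower
    estimate depends on this.\<close>
  obtain N :: nat where N: "M - L < real N * e"
    using reals_Archimedean3[OF e] by blast
  define f where "f = (\<lambda>x. L + (\<Sum>k<N. e * u k x))"
  show thesis
  proof
    show "continuous_map X euclideanreal f"
      unfolding f_def using u
      by (intro continuous_map_add continuous_map_sum continuous_map_real_mult_left)
        (auto simp: continuous_map_in_subtopology)
  next
    fix x assume x: "x \<in> topspace X"
    \<comment> \<open>The number of whole steps below \<open>a x\<close>: the first \<open>j\<close>
      of the functions \<open>u k\<close> equal 1 at \<open>x\<close>, so the staircase has climbed
      at least \<open>j * e\<close> there.\<close>
    define j where "j = nat \<lfloor>(a x - L) / e\<rfloor>"
    have j: "real j * e \<le> a x - L" "a x - L < real (Suc j) * e"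
    proof -
      have "real j = of_int \<lfloor>(a x - L) / e\<rfloor>"
        using ab[OF x] e by (simp add: j_def)
      then have "real j \<le> (a x - L) / e" "(a x - L) / e < real (Suc j)"
        by linarith+
      with e show "real j * e \<le> a x - L" "a x - L < real (Suc j) * e"
        by (simp_all add: field_simps)
    qed
    have "real j * e < real N * e" using j N ab[OF x] by linarith
    then have jN: "j < N" using e by simp
    have "u k x = 1" if "k < j" for k
    proof (rule u1[OF x])
      have "real (Suc k) * e \<le> real j * e"
        using that e by (intro mult_right_mono) auto
      then show "L + real (Suc k) * e \<le> a x" using j by linarith
    qed
    then have "real j * e = (\<Sum>k<j. e * u k x)" by simp
    also have "\<dots> \<le> (\<Sum>k<N. e * u k x)"
      using jN e u01[OF x] by (intro sum_mono2) auto
    finally have lower: "a x - e \<le> f x"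
      using j by (simp add: f_def algebra_simps)
    \<comment> \<open>The first level at or above \<open>b x\<close>: from index \<open>m\<close> on
      every \<open>u k\<close> vanishes at \<open>x\<close>, so the staircase climbs at most
      \<open>m * e\<close> there.\<close>
    define m where "m = nat \<lceil>(b x - L) / e\<rceil>"
    have m: "b x - L \<le> real m * e" "real m * e \<le> b x - L + e"
    proof -
      have "real m = of_int \<lceil>(b x - L) / e\<rceil>"
        using ab[OF x] e by (simp add: m_def)
      then have "(b x - L) / e \<le> real m" "real m \<le> (b x - L) / e + 1"
        by linarith+
      with e show "b x - L \<le> real m * e" "real m * e \<le> b x - L + e"
        by (simp_all add: field_simps)
    qed
    have "u k x = 0" if "m \<le> k" for k
    proof (rule u0[OF x])
      have "real m * e \<le> real k * e"
        using that e by (intro mult_right_mono) auto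
      then show "b x \<le> L + real k * e" using m by linarith
    qed
    then have "(\<Sum>k<N. e * u k x) \<le> (\<Sum>k<N. if k < m then e else 0)"
      using u01[OF x] e by (intro sum_mono) auto
    also have "\<dots> = (\<Sum>k\<in>{..<N} \<inter> {..<m}. e)"
      by (simp add: sum.If_cases lessThan_def)
    also have "\<dots> \<le> real m * e"
      using e card_mono[of "{..<m}" "{..<N} \<inter> {..<m}"] by simp
    finally have "f x \<le> b x + e" using m by (simp add: f_def)
    with lower show "a x - e \<le> f x \<and> f x \<le> b x + e" by simp
  qed
qed

text \<open>Approximate insertions with errors \<open>e n\<close> tending to 0 are chosen
  successively, each uniformly close to its predecessor. The distances are summable, so the sequence
  converges uniformly to a continuous limit, and the errors disappear in the limit.\<close>

theorem Katetov_Tong_insertion: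
  fixes a b :: "'a \<Rightarrow> real"
  assumes X: "normal_space X"
    and a: "upper_semicontinuous_real X a" and b: "lower_semicontinuous_real X b"
    and ab: "\<And>x. x \<in> topspace X \<Longrightarrow> L \<le> a x \<and> a x \<le> b x \<and> b x \<le> M"
  obtains f where "continuous_map X euclideanreal f"
    "\<And>x. x \<in> topspace X \<Longrightarrow> a x \<le> f x \<and> f x \<le> b x"
proof -
  define e :: "nat \<Rightarrow> real" where "e = (\<lambda>n. (1/2) ^ n)"
  have e0: "e n > 0" and eSuc: "e n = 2 * e (Suc n)" for n by (auto simp: e_def)
  define P where "P = (\<lambda>n f. continuous_map X euclideanreal f \<and>
    (\<forall>x\<in>topspace X. a x - e n \<le> f x \<and> f x \<le> b x + e n))"
  have "\<exists>F. \<forall>n. P n (F n) \<and> (\<forall>x\<in>topspace X. \<bar>F (Suc n) x - F n x\<bar> \<le> 3 * e (Suc n))"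
  proof (rule dependent_nat_choice)
    show "\<exists>f. P 0 f"
    proof -
      have "L \<le> a x \<and> a x \<le> b x \<and> a x \<le> M" if "x \<in> topspace X" for x
        using ab[OF that] by linarith
      then obtain f where "continuous_map X euclideanreal f"
        "\<And>x. x \<in> topspace X \<Longrightarrow> a x - e 0 \<le> f x \<and> f x \<le> b x + e 0"
        using approximate_insertion[OF X a b _ e0[of 0], where L = L and M = M] by auto
      then show ?thesis unfolding P_def by blast
    qed
  next
    fix f n assume "P n f"
    then have f: "continuous_map X euclideanreal f"
      and f': "\<And>x. x \<in> topspace X \<Longrightarrow> a x - e n \<le> f x \<and> f x \<le> b x + e n"
      by (auto simp: P_def)
    \<comment> \<open>Clipping the bounds to within \<open>e n\<close> of \<open>f\<close> forces the next approximation to be close to \<open>f\<close>.\<close>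
    have "upper_semicontinuous_real X (\<lambda>x. max (a x) (f x - e n))"
      using a f continuous_map_iff_semicontinuous[of X "\<lambda>x. f x - e n"]
      by (intro upper_semicontinuous_real_max) (auto intro: continuous_map_diff)
    moreover have "lower_semicontinuous_real X (\<lambda>x. min (b x) (f x + e n))"
      using b f continuous_map_iff_semicontinuous[of X "\<lambda>x. f x + e n"]
      by (intro lower_semicontinuous_real_min) (auto intro: continuous_map_add)
    moreover have "L \<le> max (a x) (f x - e n) \<and> max (a x) (f x - e n) \<le> min (b x) (f x + e n)
        \<and> max (a x) (f x - e n) \<le> M" if "x \<in> topspace X" for x
      using ab[OF that] f'[OF that] e0[of n] by auto
    ultimately obtain g where g: "continuous_map X euclideanreal g"
      "\<And>x. x \<in> topspace X \<Longrightarrow> max (a x) (f x - e n) - e (Suc n) \<le> g x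
          \<and> g x \<le> min (b x) (f x + e n) + e (Suc n)"
      using approximate_insertion[OF X _ _ _ e0[of "Suc n"],
          where a = "\<lambda>x. max (a x) (f x - e n)" and b = "\<lambda>x. min (b x) (f x + e n)"
            and L = L and M = M]
      by auto
    have "P (Suc n) g" using g unfolding P_def by fastforce
    \<comment> \<open>Clipping permits a deviation of \<open>e n\<close>, which is
      \<open>2 * e (Suc n)\<close>, and the new approximation adds one more
      \<open>e (Suc n)\<close>.\<close>
    moreover have "\<bar>g x - f x\<bar> \<le> 3 * e (Suc n)" if "x \<in> topspace X" for x
      using g(2)[OF that] eSuc[of n] by auto
    ultimately show "\<exists>g. P (Suc n) g \<and> (\<forall>x\<in>topspace X. \<bar>g x - f x\<bar> \<le> 3 * e (Suc n))"
      by blast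
  qed
  then obtain F where F: "\<And>n. P n (F n)"
    and step: "\<And>n x. x \<in> topspace X \<Longrightarrow> \<bar>F (Suc n) x - F n x\<bar> \<le> 3 * e (Suc n)"
    by blast
  \<comment> \<open>Since \<open>e (Suc n) = e n - e (Suc n)\<close>, the step bounds
    telescope.\<close>
  have tail: "\<bar>F (m + k) x - F m x\<bar> \<le> 3 * (e m - e (m + k))" if "x \<in> topspace X" for m k x
  proof (induction k)
    case (Suc k)
    with step[OF that, of "m + k"] eSuc[of "m + k"] show ?case by simp
  qed simp
  have small: "\<exists>N. \<forall>n\<ge>N. e n < d" if "d > 0" for d
  proof -
    have "e \<longlonglongrightarrow> 0" unfolding e_def by (rule LIMSEQ_realpow_zero) auto
    then show ?thesis
      using that order_tendstoD(2) eventually_sequentially by metis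
  qed
  have Cauchy: "\<exists>N. \<forall>m n x. N \<le> m \<longrightarrow> N \<le> n \<longrightarrow> x \<in> topspace X \<longrightarrow> dist (F m x) (F n x) < d"
    if d: "d > 0" for d
  proof -
    obtain N where N: "\<forall>n\<ge>N. e n < d / 3" using small[of "d / 3"] d by auto
    have *: "dist (F m x) (F n x) < d" if "N \<le> m" "m \<le> n" "x \<in> topspace X" for m n x
      using tail[OF that(3), of m "n - m"] N[rule_format, OF that(1)] e0[of n] that
      by (simp add: dist_real_def)
    have "dist (F m x) (F n x) < d" if "N \<le> m" "N \<le> n" "x \<in> topspace X" for m n x
      using *[of m n x] *[of n m x] that by (cases "m \<le> n") (auto simp: dist_commute)
    then show ?thesis by blast
  qed
  \<comment> \<open>Completeness of the reals turns the uniformly Cauchy sequence of continuous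
    functions into a continuous uniform limit.\<close>
  obtain f where f: "continuous_map X euclideanreal f"
    and lim: "\<And>d. 0 < d \<Longrightarrow> \<forall>\<^sub>F n in sequentially. \<forall>x\<in>topspace X. dist (F n x) (f x) < d"
  proof (rule Met_TC.continuous_map_uniformly_Cauchy_limit[where X = X and f = F])
    show "\<forall>\<^sub>F n in sequentially. continuous_map X Met_TC.mtopology (F n)"
      using F by (simp add: P_def)
  qed (use Cauchy in \<open>auto simp: complete_UNIV\<close>)
  show thesis
  proof
    fix x assume x: "x \<in> topspace X"
    have "a x \<le> f x + d \<and> f x \<le> b x + d" if d: "d > 0" for d
    proof -
      obtain N where N: "\<forall>n\<ge>N. e n < d / 2" using small[of "d / 2"] d by auto
      obtain N' where N': "\<forall>n\<ge>N'. dist (F n x) (f x) < d / 2"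
        using lim[of "d / 2"] d x unfolding eventually_sequentially by auto
      define n where "n = max N N'"
      have "e n < d / 2" "\<bar>F n x - f x\<bar> < d / 2"
        using N N' by (auto simp: n_def dist_real_def)
      moreover have "a x - e n \<le> F n x" "F n x \<le> b x + e n"
        using F[of n] x by (auto simp: P_def)
      ultimately show ?thesis by linarith
    qed
    then show "a x \<le> f x \<and> f x \<le> b x"
      by (auto intro: field_le_epsilon)
  qed (use f in simp)
qed

section \<open>Locally finite closed shrinkings\<close>

text \<open>The definition supplies a refinement without indices. Its members are grouped by a
  chosen \<open>V n\<close> containing them. Each index whose group meets a neighbourhood comes from
  a member that meets it, so local finiteness holds even when indices are counted instead of
  sets.\<close>

lemma countably_paracompact_locally_finite_sequence:
  assumes X: "countably_paracompact_space X"
    and V: "\<And>n::nat. openin X (V n)" "(\<Union>n. V n) = topspace X"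
  obtains W where "\<And>n. openin X (W n)" "\<And>n. W n \<subseteq> V n" "(\<Union>n. W n) = topspace X"
    "\<And>x. x \<in> topspace X \<Longrightarrow> \<exists>N. openin X N \<and> x \<in> N \<and> finite {n. W n \<inter> N \<noteq> {}}"
proof -
  have "countable (range V) \<and> open_cover X (range V)"
    using V by (auto simp: open_cover_def)
  with X have "\<exists>\<V>. open_cover X \<V> \<and> refines \<V> (range V) \<and> locally_finite_in X \<V>"
    unfolding countably_paracompact_space_def by (elim allE[of _ "range V"] impE)
  then obtain \<V> where \<V>: "open_cover X \<V>" "refines \<V> (range V)" "locally_finite_in X \<V>"
    by (elim exE conjE)
  have *: "\<forall>U\<in>\<V>. \<exists>n. U \<subseteq> V n"
    using \<V>(2) by (simp add: refines_def)
  obtain k where k: "\<forall>U\<in>\<V>. U \<subseteq> V (k U)"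
    using bchoice[OF *] by (elim exE)
  define W where "W = (\<lambda>n. \<Union>{U \<in> \<V>. k U = n})"
  show thesis
  proof
    show "openin X (W n)" for n using \<V>(1) unfolding W_def open_cover_def by blast
    show "W n \<subseteq> V n" for n using k unfolding W_def by blast
    show "(\<Union>n. W n) = topspace X" using \<V>(1) unfolding W_def open_cover_def by blast
    fix x assume "x \<in> topspace X"
    then obtain N where N: "openin X N" "x \<in> N" "finite {U \<in> \<V>. U \<inter> N \<noteq> {}}"
      using \<V>(3) unfolding locally_finite_in_def by blast
    have "{n. W n \<inter> N \<noteq> {}} \<subseteq> k ` {U \<in> \<V>. U \<inter> N \<noteq> {}}"
      unfolding W_def by blast
    with N show "\<exists>N. openin X N \<and> x \<in> N \<and> finite {n. W n \<inter> N \<noteq> {}}"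
      by (meson finite_imageI finite_subset)
  qed
qed

text \<open>The cover is shrunk one set at a time. What the earlier shrunken sets and the later
  original sets leave uncovered is closed and lies in \<open>W n\<close>; normality puts an open set
  around it whose closure stays in \<open>W n\<close>.\<close>

lemma normal_space_closed_shrinking:
  fixes W :: "nat \<Rightarrow> 'a set"
  assumes X: "normal_space X"
    and W: "\<And>n. openin X (W n)" "(\<Union>n. W n) = topspace X"
    and fin: "\<And>x. x \<in> topspace X \<Longrightarrow> finite {n. x \<in> W n}"
  obtains F where "\<And>n. closedin X (F n)" "\<And>n. F n \<subseteq> W n" "(\<Union>n. F n) = topspace X"
proof -
  define s where "s = (\<lambda>C D. SOME U. openin X U \<and> C \<subseteq> U \<and> X closure_of U \<subseteq> D)"
  have s: "openin X (s C D) \<and> C \<subseteq> s C D \<and> X closure_of (s C D) \<subseteq> D"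
    if "closedin X C" "C \<subseteq> D" "openin X D" for C D
  proof -
    have "\<exists>U. openin X U \<and> C \<subseteq> U \<and> X closure_of U \<subseteq> D"
      using X that unfolding normal_space_alt by simp
    from someI_ex[OF this] show ?thesis by (simp add: s_def)
  qed
  \<comment> \<open>\<open>U n\<close> is the union of the first \<open>n\<close> shrunken sets; together with the tail \<open>T n\<close> it covers \<open>X\<close>,
      and point-finiteness makes the tail disappear in the limit.\<close>
  define T where "T = (\<lambda>n. \<Union>m\<in>{n..}. W m)"
  define G where "G = (\<lambda>n U. s (topspace X - (U \<union> T (Suc n))) (W n))"
  define U where "U = rec_nat {} (\<lambda>n U. U \<union> G n U)"
  have U_simps: "U 0 = {}" "U (Suc n) = U n \<union> G n (U n)" for n
    by (simp_all add: U_def)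
  have T: "openin X (T n)" "T n = W n \<union> T (Suc n)" for n
  proof -
    show "openin X (T n)" using W by (auto simp: T_def)
    have "{n..} = insert n {Suc n..}" by auto
    then show "T n = W n \<union> T (Suc n)" by (simp add: T_def)
  qed
  have step: "openin X (G n (U n)) \<and> X closure_of (G n (U n)) \<subseteq> W n \<and>
      topspace X - (U n \<union> T (Suc n)) \<subseteq> G n (U n)"
    if "openin X (U n)" "topspace X \<subseteq> U n \<union> T n" for n
  proof -
    have "topspace X - (U n \<union> T (Suc n)) \<subseteq> W n" using that(2) T(2)[of n] by blast
    moreover have "closedin X (topspace X - (U n \<union> T (Suc n)))"
      using that(1) T(1) by (intro closedin_diff closedin_topspace openin_Un) auto
    ultimately show ?thesis using s[OF _ _ W(1)] unfolding G_def by simp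
  qed
  have inv: "openin X (U n) \<and> topspace X \<subseteq> U n \<union> T n" for n
  proof (induction n)
    case 0
    then show ?case using W by (auto simp: U_simps T_def)
  next
    case (Suc n)
    then have "openin X (U n)" "topspace X \<subseteq> U n \<union> T n" by auto
    from step[OF this] Suc show ?case by (auto simp: U_simps)
  qed
  have G: "openin X (G n (U n)) \<and> X closure_of (G n (U n)) \<subseteq> W n" for n
    using step[of n] inv[of n] by simp
  have Usub: "U n \<subseteq> (\<Union>k<n. G k (U k))" for n
    by (induction n) (auto simp: U_simps lessThan_Suc)
  show thesis
  proof
    show "closedin X (X closure_of (G n (U n)))" for n by simp
    show "X closure_of (G n (U n)) \<subseteq> W n" for n using G by blast
    show "(\<Union>n. X closure_of (G n (U n))) = topspace X"
    proof
      show "topspace X \<subseteq> (\<Union>n. X closure_of (G n (U n)))"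
      proof
        fix x assume x: "x \<in> topspace X"
        then obtain n where n: "\<forall>k\<in>{n. x \<in> W n}. k < n"
          using fin[OF x] unfolding finite_nat_set_iff_bounded by (elim exE)
        then have "x \<notin> T n" by (force simp: T_def)
        with inv[of n] x Usub[of n] obtain k where "x \<in> G k (U k)" by blast
        moreover have "G k (U k) \<subseteq> X closure_of (G k (U k))"
          using G[of k] openin_subset by (intro closure_of_subset) auto
        ultimately show "x \<in> (\<Union>n. X closure_of (G n (U n)))" by blast
      qed
      show "(\<Union>n. X closure_of (G n (U n))) \<subseteq> topspace X"
        by (simp add: UN_least closure_of_subset_topspace)
    qed
  qed
qed

text \<open>Countable paracompactness first makes the cover locally finite, hence point-finite, and
  only then is it shrunk; smaller sets inherit local finiteness.\<close>

lemma countably_paracompact_normal_closed_shrinking: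
  assumes "countably_paracompact_space X" "normal_space X"
    and V: "\<And>n::nat. openin X (V n)" "(\<Union>n. V n) = topspace X"
  obtains F where "\<And>n. closedin X (F n)" "\<And>n. F n \<subseteq> V n" "(\<Union>n. F n) = topspace X"
    "\<And>x. x \<in> topspace X \<Longrightarrow> \<exists>N. openin X N \<and> x \<in> N \<and> finite {n. F n \<inter> N \<noteq> {}}"
proof -
  obtain W where W: "\<And>n. openin X (W n)" "\<And>n. W n \<subseteq> V n" "(\<Union>n. W n) = topspace X"
    "\<And>x. x \<in> topspace X \<Longrightarrow> \<exists>N. openin X N \<and> x \<in> N \<and> finite {n. W n \<inter> N \<noteq> {}}"
    using countably_paracompact_locally_finite_sequence[OF assms(1) V] by metis
  have "finite {n. x \<in> W n}" if x: "x \<in> topspace X" for x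
  proof -
    obtain N where "x \<in> N" "finite {n. W n \<inter> N \<noteq> {}}" using W(4)[OF x] by blast
    then show ?thesis by (auto elim: finite_subset[rotated])
  qed
  then obtain F where F: "\<And>n. closedin X (F n)" "\<And>n. F n \<subseteq> W n" "(\<Union>n. F n) = topspace X"
    using normal_space_closed_shrinking[OF assms(2) W(1,3)] by metis
  show thesis
  proof
    fix x assume "x \<in> topspace X"
    then obtain N where N: "openin X N" "x \<in> N" "finite {n. W n \<inter> N \<noteq> {}}"
      using W(4) by blast
    have "{n. F n \<inter> N \<noteq> {}} \<subseteq> {n. W n \<inter> N \<noteq> {}}" using F(2) by blast
    with N show "\<exists>N. openin X N \<and> x \<in> N \<and> finite {n. F n \<inter> N \<noteq> {}}"
      using finite_subset by blast
  qed (use F W in blast)+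
qed

text \<open>The minimum exceeds \<open>t\<close> exactly where \<open>p\<close> does and no
  \<open>F n\<close> with \<open>r n \<le> t\<close> contains the point. The union of those
  \<open>F n\<close> is closed by local finiteness.\<close>

lemma lower_semicontinuous_real_Min_locally_finite:
  fixes r :: "nat \<Rightarrow> real"
  assumes p: "lower_semicontinuous_real X p"
    and F: "\<And>n. closedin X (F n)"
    and fin: "\<And>x. x \<in> topspace X \<Longrightarrow> \<exists>N. openin X N \<and> x \<in> N \<and> finite {n. F n \<inter> N \<noteq> {}}"
  shows "lower_semicontinuous_real X (\<lambda>x. Min (insert (p x) (r ` {n. x \<in> F n})))"
  unfolding lower_semicontinuous_real_def
proof
  fix t
  have "locally_finite_in X (F ` {n. r n \<le> t})"
    unfolding locally_finite_in_def
  proof (intro conjI ballI)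
    show "\<Union> (F ` {n. r n \<le> t}) \<subseteq> topspace X" using F closedin_subset by blast
    fix x assume "x \<in> topspace X"
    then obtain N where N: "openin X N" "x \<in> N" "finite {n. F n \<inter> N \<noteq> {}}"
      using fin by blast
    have "{U \<in> F ` {n. r n \<le> t}. U \<inter> N \<noteq> {}} \<subseteq> F ` {n. F n \<inter> N \<noteq> {}}" by auto
    with N show "\<exists>V. openin X V \<and> x \<in> V \<and> finite {U \<in> F ` {n. r n \<le> t}. U \<inter> V \<noteq> {}}"
      by (meson finite_imageI finite_subset)
  qed
  then have "closedin X (\<Union>(F ` {n. r n \<le> t}))"
    using F by (intro closedin_locally_finite_Union) auto
  moreover have "{x \<in> topspace X. Min (insert (p x) (r ` {n. x \<in> F n})) > t} =
      {x \<in> topspace X. p x > t} - \<Union>(F ` {n. r n \<le> t})"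
  proof -
    have "finite {n. x \<in> F n}" if x: "x \<in> topspace X" for x
    proof -
      obtain N where "x \<in> N" "finite {n. F n \<inter> N \<noteq> {}}" using fin[OF x] by blast
      then show ?thesis by (auto elim: finite_subset[rotated])
    qed
    then show ?thesis by (force simp: not_le)
  qed
  ultimately show "openin X {x \<in> topspace X. Min (insert (p x) (r ` {n. x \<in> F n})) > t}"
    using p unfolding lower_semicontinuous_real_def by auto
qed

section \<open>Set-valued mappings into a real interval\<close>

text \<open>A supremum exceeds \<open>r\<close> exactly when some element does, so the set in
  question consists of the points whose value meets an open ray.\<close>

lemma lsc_map_Sup:
  fixes \<Phi> :: "'a \<Rightarrow> real set"
  assumes "lsc_map X (top_of_set S) \<Phi>"
    and sub: "\<And>x. x \<in> topspace X \<Longrightarrow> \<Phi> x \<subseteq> S \<and> \<Phi> x \<noteq> {} \<and> bdd_above (\<Phi> x)"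
  shows "lower_semicontinuous_real X (\<lambda>x. Sup (\<Phi> x))"
  unfolding lower_semicontinuous_real_def
proof
  fix r
  have "openin X {x \<in> topspace X. \<Phi> x \<inter> (S \<inter> {r<..}) \<noteq> {}}"
    using assms(1) unfolding lsc_map_def by (simp add: openin_open_Int)
  moreover have "{x \<in> topspace X. Sup (\<Phi> x) > r} = {x \<in> topspace X. \<Phi> x \<inter> (S \<inter> {r<..}) \<noteq> {}}"
    using sub by (force simp: less_cSup_iff)
  ultimately show "openin X {x \<in> topspace X. Sup (\<Phi> x) > r}" by simp
qed

lemma lsc_map_Inf:
  fixes \<Phi> :: "'a \<Rightarrow> real set"
  assumes "lsc_map X (top_of_set S) \<Phi>"
    and sub: "\<And>x. x \<in> topspace X \<Longrightarrow> \<Phi> x \<subseteq> S \<and> \<Phi> x \<noteq> {} \<and> bdd_below (\<Phi> x)"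
  shows "upper_semicontinuous_real X (\<lambda>x. Inf (\<Phi> x))"
  unfolding upper_semicontinuous_real_def
proof
  fix r
  have "openin X {x \<in> topspace X. \<Phi> x \<inter> (S \<inter> {..<r}) \<noteq> {}}"
    using assms(1) unfolding lsc_map_def by (simp add: openin_open_Int)
  moreover have "{x \<in> topspace X. Inf (\<Phi> x) < r} = {x \<in> topspace X. \<Phi> x \<inter> (S \<inter> {..<r}) \<noteq> {}}"
    using sub by (force simp: cInf_less_iff)
  ultimately show "openin X {x \<in> topspace X. Inf (\<Phi> x) < r}" by simp
qed

text \<open>By compactness the supremum is attained, so it stays below \<open>r\<close> exactly when
  the value misses the closed ray from \<open>r\<close> upwards.\<close>

lemma usc_map_Sup:
  fixes \<Phi> :: "'a \<Rightarrow> real set"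
  assumes "usc_map X (top_of_set S) \<Phi>"
    and sub: "\<And>x. x \<in> topspace X \<Longrightarrow> \<Phi> x \<subseteq> S \<and> \<Phi> x \<noteq> {} \<and> compact (\<Phi> x)"
  shows "upper_semicontinuous_real X (\<lambda>x. Sup (\<Phi> x))"
  unfolding upper_semicontinuous_real_def
proof
  fix r
  have "closedin X {x \<in> topspace X. \<Phi> x \<inter> (S \<inter> {r..}) \<noteq> {}}"
    using assms(1) unfolding usc_map_def by (simp add: closedin_closed_Int)
  moreover have "Sup (\<Phi> x) < r \<longleftrightarrow> \<Phi> x \<inter> (S \<inter> {r..}) = {}" if x: "x \<in> topspace X" for x
  proof -
    obtain s where s: "s \<in> \<Phi> x" "\<forall>t\<in>\<Phi> x. t \<le> s"
      using compact_attains_sup[of "\<Phi> x"] sub[OF x] by blast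
    then have "Sup (\<Phi> x) = s" by (intro cSup_eq_maximum) auto
    moreover have "\<Phi> x \<inter> (S \<inter> {r..}) = {} \<longleftrightarrow> (\<forall>t\<in>\<Phi> x. t < r)"
      unfolding disjoint_iff using sub[OF x] by (auto simp: not_le)
    moreover have "(\<forall>t\<in>\<Phi> x. t < r) \<longleftrightarrow> s < r"
      using s by (meson le_less_trans)
    ultimately show ?thesis by simp
  qed
  then have "{x \<in> topspace X. Sup (\<Phi> x) < r} =
      topspace X - {x \<in> topspace X. \<Phi> x \<inter> (S \<inter> {r..}) \<noteq> {}}"
    by auto
  ultimately show "openin X {x \<in> topspace X. Sup (\<Phi> x) < r}" by auto
qed

lemma usc_map_Inf:
  fixes \<Phi> :: "'a \<Rightarrow> real set"
  assumes "usc_map X (top_of_set S) \<Phi>"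
    and sub: "\<And>x. x \<in> topspace X \<Longrightarrow> \<Phi> x \<subseteq> S \<and> \<Phi> x \<noteq> {} \<and> compact (\<Phi> x)"
  shows "lower_semicontinuous_real X (\<lambda>x. Inf (\<Phi> x))"
  unfolding lower_semicontinuous_real_def
proof
  fix r
  have "closedin X {x \<in> topspace X. \<Phi> x \<inter> (S \<inter> {..r}) \<noteq> {}}"
    using assms(1) unfolding usc_map_def by (simp add: closedin_closed_Int)
  moreover have "r < Inf (\<Phi> x) \<longleftrightarrow> \<Phi> x \<inter> (S \<inter> {..r}) = {}" if x: "x \<in> topspace X" for x
  proof -
    obtain s where s: "s \<in> \<Phi> x" "\<forall>t\<in>\<Phi> x. s \<le> t"
      using compact_attains_inf[of "\<Phi> x"] sub[OF x] by blast
    then have "Inf (\<Phi> x) = s" by (intro cInf_eq_minimum) auto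
    moreover have "\<Phi> x \<inter> (S \<inter> {..r}) = {} \<longleftrightarrow> (\<forall>t\<in>\<Phi> x. r < t)"
      unfolding disjoint_iff using sub[OF x] by (auto simp: not_le)
    moreover have "(\<forall>t\<in>\<Phi> x. r < t) \<longleftrightarrow> r < s"
      using s by (meson less_le_trans)
    ultimately show ?thesis by simp
  qed
  then have "{x \<in> topspace X. r < Inf (\<Phi> x)} =
      topspace X - {x \<in> topspace X. \<Phi> x \<inter> (S \<inter> {..r}) \<noteq> {}}"
    by auto
  ultimately show "openin X {x \<in> topspace X. r < Inf (\<Phi> x)}" by auto
qed

text \<open>If \<open>y\<close> lies in the interval at \<open>x\<close>, then nearby the lower end
  is below \<open>y + e\<close> and the upper end above \<open>y - e\<close>, so some point of the
  nearby interval is within \<open>e\<close> of \<open>y\<close>.\<close>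

lemma lsc_map_atLeastAtMost:
  fixes g h :: "'a \<Rightarrow> real"
  assumes g: "upper_semicontinuous_real X g" and h: "lower_semicontinuous_real X h"
    and gh: "\<And>x. x \<in> topspace X \<Longrightarrow> g x \<le> h x \<and> {g x..h x} \<subseteq> S"
  shows "lsc_map X (top_of_set S) (\<lambda>x. {g x..h x})"
  unfolding lsc_map_def
proof (intro allI impI)
  fix U assume "openin (top_of_set S) U"
  then obtain T where T: "open T" "U = S \<inter> T" unfolding openin_open by blast
  show "openin X {x \<in> topspace X. {g x..h x} \<inter> U \<noteq> {}}"
  proof (subst openin_subopen, rule ballI)
    fix x assume "x \<in> {x \<in> topspace X. {g x..h x} \<inter> U \<noteq> {}}"
    then obtain y where x: "x \<in> topspace X" and y: "g x \<le> y" "y \<le> h x" "y \<in> T"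
      using T by auto
    obtain e where e: "e > 0" "ball y e \<subseteq> T" using T y open_contains_ball by blast
    let ?N = "{z \<in> topspace X. g z < y + e} \<inter> {z \<in> topspace X. h z > y - e}"
    have "openin X ?N"
      using g h unfolding upper_semicontinuous_real_def lower_semicontinuous_real_def by blast
    moreover have "x \<in> ?N" using x y e by auto
    moreover have "?N \<subseteq> {x \<in> topspace X. {g x..h x} \<inter> U \<noteq> {}}"
    proof
      fix z assume z: "z \<in> ?N"
      \<comment> \<open>The point \<open>y\<close> clamped to the interval at
        \<open>z\<close>.\<close>
      define w where "w = max (g z) (min y (h z))"
      have "w \<in> {g z..h z}" using z gh[of z] by (auto simp: w_def)
      moreover have "w \<in> ball y e" using z e by (auto simp: w_def dist_real_def)
      ultimately have "w \<in> {g z..h z} \<inter> U" using T e gh[of z] z by blast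
      then show "z \<in> {x \<in> topspace X. {g x..h x} \<inter> U \<noteq> {}}" using z by blast
    qed
    ultimately show "\<exists>N. openin X N \<and> x \<in> N \<and> N \<subseteq> {x \<in> topspace X. {g x..h x} \<inter> U \<noteq> {}}"
      by blast
  qed
qed

text \<open>When the interval at \<open>x\<close> misses a closed set, so do small balls around both
  ends, and nearby intervals lie in the union of the interval and these balls.\<close>

lemma usc_map_atLeastAtMost:
  fixes g h :: "'a \<Rightarrow> real"
  assumes g: "lower_semicontinuous_real X g" and h: "upper_semicontinuous_real X h"
    and gh: "\<And>x. x \<in> topspace X \<Longrightarrow> g x \<le> h x \<and> {g x..h x} \<subseteq> S"
  shows "usc_map X (top_of_set S) (\<lambda>x. {g x..h x})"
  unfolding usc_map_def
proof (intro allI impI)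
  fix F assume "closedin (top_of_set S) F"
  then obtain T where T: "closed T" "F = S \<inter> T" unfolding closedin_closed by blast
  have "openin X {x \<in> topspace X. {g x..h x} \<inter> F = {}}"
  proof (subst openin_subopen, rule ballI)
    fix x assume "x \<in> {x \<in> topspace X. {g x..h x} \<inter> F = {}}"
    \<comment> \<open>The intervals lie in \<open>S\<close>, so meeting \<open>F\<close> is the same
      as meeting \<open>T\<close>.\<close>
    then have x: "x \<in> topspace X" and disj: "{g x..h x} \<inter> T = {}"
      using T gh by auto
    then have "g x \<in> - T" "h x \<in> - T" using gh[OF x] by auto
    then obtain d e where d: "d > 0" "ball (g x) d \<subseteq> - T" and e: "e > 0" "ball (h x) e \<subseteq> - T"
      using T by (meson open_Compl open_contains_ball)
    let ?N = "{z \<in> topspace X. g z > g x - d} \<inter> {z \<in> topspace X. h z < h x + e}"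
    have "openin X ?N"
      using g h unfolding upper_semicontinuous_real_def lower_semicontinuous_real_def by blast
    moreover have "x \<in> ?N" using x d e by auto
    moreover have "?N \<subseteq> {x \<in> topspace X. {g x..h x} \<inter> F = {}}"
    proof
      fix z assume z: "z \<in> ?N"
      have "y \<notin> T" if "y \<in> {g z..h z}" for y
      proof -
        consider "y \<in> {g x..h x}" | "y < g x" | "h x < y" by fastforce
        then show ?thesis
        proof cases
          case 2
          then have "y \<in> ball (g x) d" using that z by (auto simp: dist_real_def)
          with d show ?thesis by blast
        next
          case 3
          then have "y \<in> ball (h x) e" using that z by (auto simp: dist_real_def)
          with e show ?thesis by blast
        qed (use disj in blast)
      qed
      with z T show "z \<in> {x \<in> topspace X. {g x..h x} \<inter> F = {}}" by blast
    qed
    ultimately show "\<exists>N. openin X N \<and> x \<in> N \<and> N \<subseteq> {x \<in> topspace X. {g x..h x} \<inter> F = {}}"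
      by blast
  qed
  moreover have "{x \<in> topspace X. {g x..h x} \<inter> F \<noteq> {}} =
      topspace X - {x \<in> topspace X. {g x..h x} \<inter> F = {}}" by auto
  ultimately show "closedin X {x \<in> topspace X. {g x..h x} \<inter> F \<noteq> {}}"
    by auto
qed

lemma nonempty_compact_sets_atLeastAtMost:
  "nonempty_compact_sets (top_of_set {l..u::real}) = {S. compact S \<and> S \<noteq> {} \<and> S \<subseteq> {l..u}}"
  by (auto simp: nonempty_compact_sets_def compactin_subtopology)

lemma nonempty_compact_connected_sets_atLeastAtMost:
  "nonempty_compact_connected_sets (top_of_set {l..u::real}) =
     {{s..t} | s t. l \<le> s \<and> s \<le> t \<and> t \<le> u}"
proof -
  have "nonempty_compact_connected_sets (top_of_set {l..u}) =
      {S. (connected S \<and> compact S) \<and> S \<noteq> {} \<and> S \<subseteq> {l..u}}"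
    by (auto simp: nonempty_compact_connected_sets_def nonempty_compact_sets_atLeastAtMost
        connectedin_subtopology)
  also have "\<dots> = {S. \<exists>s t. S = {s..t} \<and> l \<le> s \<and> s \<le> t \<and> t \<le> u}"
  proof (rule Collect_cong)
    fix S :: "real set"
    have "{s..t} \<noteq> {} \<and> {s..t} \<subseteq> {l..u} \<longleftrightarrow> l \<le> s \<and> s \<le> t \<and> t \<le> u" for s t
      by auto
    then show "(connected S \<and> compact S) \<and> S \<noteq> {} \<and> S \<subseteq> {l..u} \<longleftrightarrow>
        (\<exists>s t. S = {s..t} \<and> l \<le> s \<and> s \<le> t \<and> t \<le> u)"
      unfolding connected_compact_interval_1 by metis
  qed
  finally show ?thesis .
qed

text \<open>The ambient interval is compact, so its relatively closed subsets are exactly its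
  compact ones.\<close>

lemma nonempty_closed_connected_sets_atLeastAtMost:
  "nonempty_closed_connected_sets (top_of_set {l..u::real}) =
     {{s..t} | s t. l \<le> s \<and> s \<le> t \<and> t \<le> u}"
proof -
  have "closedin (top_of_set {l..u}) S \<longleftrightarrow> compact S \<and> S \<subseteq> {l..u}" for S
    using closedin_closed_eq[of "{l..u}" S] compact_imp_closed[of S]
      compact_Int_closed[of "{l..u}" S] by (auto simp: Int_absorb1)
  then have "nonempty_closed_connected_sets (top_of_set {l..u}) =
      nonempty_compact_connected_sets (top_of_set {l..u})"
    by (auto simp: nonempty_closed_connected_sets_def nonempty_compact_connected_sets_def
        nonempty_closed_sets_def nonempty_compact_sets_atLeastAtMost)
  then show ?thesis by (simp add: nonempty_compact_connected_sets_atLeastAtMost)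
qed

section \<open>The expansion property\<close>

text \<open>Condition (b) with the target space as a parameter, so that it can be moved from the
  hedgehog to a convenient interval.\<close>

definition set_expansion_property :: "'a topology \<Rightarrow> 'b topology \<Rightarrow> bool" where
  "set_expansion_property X J \<longleftrightarrow>
     (\<forall>\<Phi> \<theta>. \<Phi> \<in> topspace X \<rightarrow> nonempty_closed_connected_sets J \<and> lsc_map X J \<Phi> \<and>
        \<theta> \<in> topspace X \<rightarrow> nonempty_compact_sets J \<and> usc_map X J \<theta> \<and>
        set_map_less X \<theta> \<Phi> \<longrightarrow>
        (\<exists>\<phi>. \<phi> \<in> topspace X \<rightarrow> nonempty_compact_connected_sets J \<and>
             continuous_set_map X J \<phi> \<and> set_map_less X \<theta> \<phi> \<and> set_map_le X \<phi> \<Phi>))"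

text \<open>Condition (c) as a named property.\<close>

definition strict_insertion_property :: "'a topology \<Rightarrow> bool" where
  "strict_insertion_property X \<longleftrightarrow>
     (\<forall>\<xi> \<eta>. upper_semicontinuous_real X \<xi> \<and> lower_semicontinuous_real X \<eta> \<and>
        (\<forall>x\<in>topspace X. \<xi> x < \<eta> x) \<longrightarrow>
        (\<exists>f. continuous_map X euclideanreal f \<and>
             (\<forall>x\<in>topspace X. \<xi> x < f x \<and> f x < \<eta> x)))"

section \<open>Transport of the expansion property along homeomorphisms\<close>

lemma lsc_map_image:
  assumes "continuous_map Y Z h" "lsc_map X Y \<Phi>"
    and sub: "\<And>x. x \<in> topspace X \<Longrightarrow> \<Phi> x \<subseteq> topspace Y"
  shows "lsc_map X Z (\<lambda>x. h ` \<Phi> x)"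
  unfolding lsc_map_def
proof (intro allI impI)
  fix U assume "openin Z U"
  then have "openin Y {y \<in> topspace Y. h y \<in> U}"
    using assms(1) openin_continuous_map_preimage by blast
  with assms(2) have "openin X {x \<in> topspace X. \<Phi> x \<inter> {y \<in> topspace Y. h y \<in> U} \<noteq> {}}"
    unfolding lsc_map_def by blast
  moreover have "{x \<in> topspace X. \<Phi> x \<inter> {y \<in> topspace Y. h y \<in> U} \<noteq> {}} =
      {x \<in> topspace X. h ` \<Phi> x \<inter> U \<noteq> {}}"
    using sub by blast
  ultimately show "openin X {x \<in> topspace X. h ` \<Phi> x \<inter> U \<noteq> {}}" by simp
qed

lemma usc_map_image:
  assumes "continuous_map Y Z h" "usc_map X Y \<Phi>"
    and sub: "\<And>x. x \<in> topspace X \<Longrightarrow> \<Phi> x \<subseteq> topspace Y"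
  shows "usc_map X Z (\<lambda>x. h ` \<Phi> x)"
  unfolding usc_map_def
proof (intro allI impI)
  fix F assume "closedin Z F"
  then have "closedin Y {y \<in> topspace Y. h y \<in> F}"
    using assms(1) closedin_continuous_map_preimage by blast
  with assms(2) have "closedin X {x \<in> topspace X. \<Phi> x \<inter> {y \<in> topspace Y. h y \<in> F} \<noteq> {}}"
    unfolding usc_map_def by blast
  moreover have "{x \<in> topspace X. \<Phi> x \<inter> {y \<in> topspace Y. h y \<in> F} \<noteq> {}} =
      {x \<in> topspace X. h ` \<Phi> x \<inter> F \<noteq> {}}"
    using sub by blast
  ultimately show "closedin X {x \<in> topspace X. h ` \<Phi> x \<inter> F \<noteq> {}}" by simp
qed

text \<open>Both given mappings are carried to \<open>J\<close> by \<open>g\<close>, expanded there,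
  and the result is carried back by \<open>h\<close>. Strictness survives because the two maps are
  mutually inverse.\<close>

lemma set_expansion_property_homeomorphic_maps:
  assumes hg: "homeomorphic_maps J K h g" and J: "set_expansion_property X J"
  shows "set_expansion_property X K"
  unfolding set_expansion_property_def
proof (intro allI impI, elim conjE)
  fix \<Phi> \<theta>
  assume \<Phi>: "\<Phi> \<in> topspace X \<rightarrow> nonempty_closed_connected_sets K" "lsc_map X K \<Phi>"
    and \<theta>: "\<theta> \<in> topspace X \<rightarrow> nonempty_compact_sets K" "usc_map X K \<theta>"
    and less: "set_map_less X \<theta> \<Phi>"
  have h: "continuous_map J K h" and g: "continuous_map K J g"
    and gh: "\<And>y. y \<in> topspace J \<Longrightarrow> g (h y) = y" and hg': "\<And>z. z \<in> topspace K \<Longrightarrow> h (g z) = z"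
    using hg by (auto simp: homeomorphic_maps_def)
  have g_homeo: "homeomorphic_map K J g"
    using hg by (simp add: homeomorphic_maps_map)
  have hgS: "h ` g ` S = S" if "S \<subseteq> topspace K" for S
  proof -
    have "\<And>z. z \<in> S \<Longrightarrow> h (g z) = z" using hg' that by blast
    then show ?thesis by (simp add: image_image)
  qed
  have \<Phi>K: "\<Phi> x \<subseteq> topspace K" "\<Phi> x \<noteq> {}" "closedin K (\<Phi> x)" "connectedin K (\<Phi> x)"
    if "x \<in> topspace X" for x
    using \<Phi>(1) that closedin_subset
    by (auto simp: nonempty_closed_connected_sets_def nonempty_closed_sets_def Pi_iff)
  have \<theta>K: "\<theta> x \<subseteq> topspace K" "\<theta> x \<noteq> {}" "compactin K (\<theta> x)" if "x \<in> topspace X" for x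
    using \<theta>(1) that compactin_subset_topspace
    by (auto simp: nonempty_compact_sets_def Pi_iff)
  have "(\<lambda>x. g ` \<Phi> x) \<in> topspace X \<rightarrow> nonempty_closed_connected_sets J"
  proof
    fix x assume x: "x \<in> topspace X"
    have "closedin J (g ` \<Phi> x)"
      using g_homeo homeomorphic_map_closedness_eq \<Phi>K(3)[OF x] by blast
    moreover have "connectedin J (g ` \<Phi> x)"
      using g \<Phi>K(4)[OF x] connectedin_continuous_map_image by blast
    ultimately show "g ` \<Phi> x \<in> nonempty_closed_connected_sets J"
      using \<Phi>K(2)[OF x] by (simp add: nonempty_closed_connected_sets_def nonempty_closed_sets_def)
  qed
  moreover have "lsc_map X J (\<lambda>x. g ` \<Phi> x)"
    by (rule lsc_map_image[OF g \<Phi>(2) \<Phi>K(1)])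
  moreover have "(\<lambda>x. g ` \<theta> x) \<in> topspace X \<rightarrow> nonempty_compact_sets J"
  proof
    fix x assume x: "x \<in> topspace X"
    show "g ` \<theta> x \<in> nonempty_compact_sets J"
      using \<theta>K(2)[OF x] image_compactin[OF \<theta>K(3)[OF x] g]
      by (simp add: nonempty_compact_sets_def)
  qed
  moreover have "usc_map X J (\<lambda>x. g ` \<theta> x)"
    by (rule usc_map_image[OF g \<theta>(2) \<theta>K(1)])
  moreover have "set_map_less X (\<lambda>x. g ` \<theta> x) (\<lambda>x. g ` \<Phi> x)"
    unfolding set_map_less_def set_map_le_def
  proof (intro conjI ballI)
    fix x assume x: "x \<in> topspace X"
    show "g ` \<theta> x \<subseteq> g ` \<Phi> x"
      using less x unfolding set_map_less_def set_map_le_def by blast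
    obtain z where z: "z \<in> \<Phi> x" "z \<notin> \<theta> x"
      using less x unfolding set_map_less_def by blast
    have "g z \<notin> g ` \<theta> x"
    proof
      assume "g z \<in> g ` \<theta> x"
      then have "h (g z) \<in> h ` g ` \<theta> x" by (rule imageI)
      with hgS[OF \<theta>K(1)[OF x]] hg' \<Phi>K(1)[OF x] z show False by auto
    qed
    with z show "g ` \<Phi> x - g ` \<theta> x \<noteq> {}" by blast
  qed
  ultimately obtain \<phi> where \<phi>: "\<phi> \<in> topspace X \<rightarrow> nonempty_compact_connected_sets J"
    "lsc_map X J \<phi>" "usc_map X J \<phi>"
    and less\<phi>: "set_map_less X (\<lambda>x. g ` \<theta> x) \<phi>" and le: "set_map_le X \<phi> (\<lambda>x. g ` \<Phi> x)"
    using J unfolding set_expansion_property_def continuous_set_map_def by metis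
  have \<phi>J: "\<phi> x \<subseteq> topspace J" "\<phi> x \<noteq> {}" "compactin J (\<phi> x)" "connectedin J (\<phi> x)"
    if "x \<in> topspace X" for x
    using \<phi>(1) that compactin_subset_topspace
    by (auto simp: nonempty_compact_connected_sets_def nonempty_compact_sets_def Pi_iff)
  show "\<exists>\<phi>. \<phi> \<in> topspace X \<rightarrow> nonempty_compact_connected_sets K \<and>
      continuous_set_map X K \<phi> \<and> set_map_less X \<theta> \<phi> \<and> set_map_le X \<phi> \<Phi>"
  proof (intro exI[of _ "\<lambda>x. h ` \<phi> x"] conjI)
    show "(\<lambda>x. h ` \<phi> x) \<in> topspace X \<rightarrow> nonempty_compact_connected_sets K"
    proof
      fix x assume x: "x \<in> topspace X"
      have "connectedin K (h ` \<phi> x)"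
        using h \<phi>J(4)[OF x] connectedin_continuous_map_image by blast
      then show "h ` \<phi> x \<in> nonempty_compact_connected_sets K"
        using \<phi>J(2)[OF x] image_compactin[OF \<phi>J(3)[OF x] h]
        by (simp add: nonempty_compact_connected_sets_def nonempty_compact_sets_def)
    qed
    show "continuous_set_map X K (\<lambda>x. h ` \<phi> x)"
      unfolding continuous_set_map_def
      using lsc_map_image[OF h \<phi>(2) \<phi>J(1)] usc_map_image[OF h \<phi>(3) \<phi>J(1)] by blast
    show "set_map_less X \<theta> (\<lambda>x. h ` \<phi> x)"
      unfolding set_map_less_def set_map_le_def
    proof (intro conjI ballI)
      fix x assume x: "x \<in> topspace X"
      have "g ` \<theta> x \<subseteq> \<phi> x"
        using less\<phi> x unfolding set_map_less_def set_map_le_def by blast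
      then have "h ` g ` \<theta> x \<subseteq> h ` \<phi> x" by (rule image_mono)
      then show "\<theta> x \<subseteq> h ` \<phi> x" using hgS[OF \<theta>K(1)[OF x]] by simp
      obtain y where y: "y \<in> \<phi> x" "y \<notin> g ` \<theta> x"
        using less\<phi> x unfolding set_map_less_def by blast
      have "h y \<notin> \<theta> x"
      proof
        assume "h y \<in> \<theta> x"
        then have "g (h y) \<in> g ` \<theta> x" by (rule imageI)
        with y gh \<phi>J(1)[OF x] show False by auto
      qed
      with y show "h ` \<phi> x - \<theta> x \<noteq> {}" by blast
    qed
    show "set_map_le X (\<lambda>x. h ` \<phi> x) \<Phi>"
      unfolding set_map_le_def
    proof
      fix x assume x: "x \<in> topspace X"
      have "\<phi> x \<subseteq> g ` \<Phi> x" using le x unfolding set_map_le_def by blast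
      then have "h ` \<phi> x \<subseteq> h ` g ` \<Phi> x" by (rule image_mono)
      then show "h ` \<phi> x \<subseteq> \<Phi> x" using hgS[OF \<Phi>K(1)[OF x]] by simp
    qed
  qed
qed

lemma homeomorphic_space_set_expansion_property:
  assumes "J homeomorphic_space K"
  shows "set_expansion_property X J \<longleftrightarrow> set_expansion_property X K"
  using assms set_expansion_property_homeomorphic_maps homeomorphic_maps_sym
  unfolding homeomorphic_space_def by metis

text \<open>An isometry is an embedding, and here its image is the whole interval.\<close>

lemma hedgehog_topology_two_homeomorphic:
  assumes "card A = 2"
  shows "hedgehog_topology A homeomorphic_space top_of_set {-1..1::real}"
proof -
  obtain \<alpha> \<beta> where A: "A = {\<alpha>, \<beta>}" "\<alpha> \<noteq> \<beta>" using assms unfolding card_2_iff by blast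
  obtain h where h: "bij_betw h (hedgehog A) {-1..1::real}"
    and iso: "\<And>x y. \<lbrakk>x \<in> hedgehog A; y \<in> hedgehog A\<rbrakk> \<Longrightarrow> \<bar>h x - h y\<bar> = hedgehog_dist x y"
    using hedgehog_two_isometric[OF A(2)] A(1) by metis
  interpret Metric_space12 "hedgehog A" hedgehog_dist UNIV "dist :: real \<Rightarrow> real \<Rightarrow> real"
    by (simp add: Metric_space12_def Metric_space_hedgehog Met_TC.Metric_space_axioms)
  have "embedding_map M1.mtopology Met_TC.mtopology h"
    by (rule isometry_imp_embedding_map) (auto simp: iso dist_real_def)
  then have "homeomorphic_map M1.mtopology (top_of_set (h ` hedgehog A)) h"
    by (simp add: embedding_map_def)
  moreover have "h ` hedgehog A = {-1..1}" using h by (simp add: bij_betw_def)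
  ultimately have "homeomorphic_map (hedgehog_topology A) (top_of_set {-1..1}) h"
    by (simp add: hedgehog_topology_def)
  then show ?thesis by (rule homeomorphic_map_imp_homeomorphic_space)
qed

text \<open>The two ends of the new interval are inserted independently: \<open>g\<close> stays
  below \<open>p\<close> and \<open>h\<close> above \<open>q\<close>, so they are automatically in
  the right order.\<close>

lemma countably_paracompact_normal_imp_set_expansion_property:
  fixes l u :: real
  assumes cp: "countably_paracompact_space X" and X: "normal_space X"
  shows "set_expansion_property X (top_of_set {l..u})"
  unfolding set_expansion_property_def
proof (intro allI impI, elim conjE)
  let ?K = "top_of_set {l..u}"
  fix \<Phi> \<theta>
  assume \<Phi>: "\<Phi> \<in> topspace X \<rightarrow> nonempty_closed_connected_sets ?K" "lsc_map X ?K \<Phi>"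
    and \<theta>: "\<theta> \<in> topspace X \<rightarrow> nonempty_compact_sets ?K" "usc_map X ?K \<theta>"
    and less: "set_map_less X \<theta> \<Phi>"
  define a where "a = (\<lambda>x. Inf (\<Phi> x))"
  define b where "b = (\<lambda>x. Sup (\<Phi> x))"
  define p where "p = (\<lambda>x. Inf (\<theta> x))"
  define q where "q = (\<lambda>x. Sup (\<theta> x))"
  have \<Phi>x: "\<Phi> x = {a x..b x}" "l \<le> a x" "a x \<le> b x" "b x \<le> u" if x: "x \<in> topspace X" for x
  proof -
    have "\<Phi> x \<in> nonempty_closed_connected_sets ?K" using \<Phi>(1) x by blast
    then obtain s t where "\<Phi> x = {s..t}" "l \<le> s" "s \<le> t" "t \<le> u"
      unfolding nonempty_closed_connected_sets_atLeastAtMost by blast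
    then show "\<Phi> x = {a x..b x}" "l \<le> a x" "a x \<le> b x" "b x \<le> u"
      by (simp_all add: a_def b_def)
  qed
  have \<theta>K: "\<theta> x \<subseteq> {l..u} \<and> \<theta> x \<noteq> {} \<and> compact (\<theta> x)" if "x \<in> topspace X" for x
    using \<theta>(1) that unfolding nonempty_compact_sets_atLeastAtMost by blast
  have bounds: "a x \<le> p x" "p x \<le> q x" "q x \<le> b x" "\<theta> x \<subseteq> {p x..q x}" if x: "x \<in> topspace X" for x
  proof -
    have sub: "\<theta> x \<subseteq> {a x..b x}"
      using less x \<Phi>x(1)[OF x] unfolding set_map_less_def set_map_le_def by blast
    then have bdd: "bdd_below (\<theta> x)" "bdd_above (\<theta> x)"
      by (auto intro: bdd_below_mono bdd_above_mono)
    show \<theta>pq: "\<theta> x \<subseteq> {p x..q x}"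
      using bdd by (auto simp: p_def q_def intro: cInf_lower cSup_upper)
    then show "p x \<le> q x" using \<theta>K[OF x] by fastforce
    show "a x \<le> p x" unfolding p_def using \<theta>K[OF x] sub by (intro cInf_greatest) auto
    show "q x \<le> b x" unfolding q_def using \<theta>K[OF x] sub by (intro cSup_least) auto
  qed
  have a: "upper_semicontinuous_real X a" and b: "lower_semicontinuous_real X b"
    unfolding a_def b_def
    by (rule lsc_map_Inf[OF \<Phi>(2)] lsc_map_Sup[OF \<Phi>(2)]; use \<Phi>x in auto)+
  have p: "lower_semicontinuous_real X p" and q: "upper_semicontinuous_real X q"
    unfolding p_def q_def
    by (rule usc_map_Inf[OF \<theta>(2) \<theta>K] usc_map_Sup[OF \<theta>(2) \<theta>K]; simp)+
  \<comment> \<open>An enumeration of all rationals: \<open>from_nat\<close> decodes a natural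
    number as a rational.\<close>
  define r :: "nat \<Rightarrow> real" where "r = (\<lambda>n. real_of_rat (from_nat n))"
  \<comment> \<open>The condition \<open>r n \<notin> \<theta> x\<close> is phrased through the
    relatively closed set \<open>{l..u} \<inter> {r n}\<close>, to which upper semicontinuity of
    \<open>\<theta>\<close> applies.\<close>
  define V where "V = (\<lambda>n. {x \<in> topspace X. a x < r n} \<inter> {x \<in> topspace X. r n < b x} \<inter>
      (topspace X - {x \<in> topspace X. \<theta> x \<inter> ({l..u} \<inter> {r n}) \<noteq> {}}))"
  have V_open: "openin X (V n)" for n
  proof -
    have "closedin ?K ({l..u} \<inter> {r n})" by (simp add: closedin_closed_Int)
    then have "closedin X {x \<in> topspace X. \<theta> x \<inter> ({l..u} \<inter> {r n}) \<noteq> {}}"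
      using \<theta>(2) unfolding usc_map_def by blast
    then show ?thesis
      using a b unfolding V_def upper_semicontinuous_real_def lower_semicontinuous_real_def
      by (intro openin_Int) auto
  qed
  have V_mem: "x \<in> V n \<longleftrightarrow> a x < r n \<and> r n < b x \<and> r n \<notin> \<theta> x" if "x \<in> topspace X" for n x
    using that \<theta>K[OF that] by (auto simp: V_def)
  have V_cover: "(\<Union>n. V n) = topspace X"
  proof
    show "topspace X \<subseteq> (\<Union>n. V n)"
    proof
      fix x assume x: "x \<in> topspace X"
      obtain y where y: "a x \<le> y" "y \<le> b x" "y \<notin> \<theta> x"
        using less x \<Phi>x(1)[OF x] unfolding set_map_less_def by fastforce
      have "closed (\<theta> x)" using \<theta>K[OF x] compact_imp_closed by blast
      then obtain e where e: "e > 0" "ball y e \<subseteq> - \<theta> x"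
        using y by (meson ComplI open_Compl open_contains_ball)
      \<comment> \<open>A nonempty \<open>\<theta> x\<close> that omits a point of
        \<open>\<Phi> x\<close> forces that interval to be nondegenerate.\<close>
      have "a x < b x"
      proof (rule ccontr)
        assume "\<not> a x < b x"
        then have "{p x..q x} \<subseteq> {y}" using y bounds[OF x] by auto
        with y bounds(4)[OF x] \<theta>K[OF x] show False by blast
      qed
      \<comment> \<open>The omitted point \<open>y\<close> may be irrational or an end of the
        interval; a nearby rational strictly inside is still outside the closed set
        \<open>\<theta> x\<close>.\<close>
      then have "max (a x) (y - e) < min (b x) (y + e)" using y e by auto
      then obtain s where s: "max (a x) (y - e) < real_of_rat s" "real_of_rat s < min (b x) (y + e)"
        using of_rat_dense by blast
      then have "real_of_rat s \<in> ball y e" by (auto simp: dist_real_def)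
      then have "real_of_rat s \<notin> \<theta> x" using e by blast
      with s have "x \<in> V (to_nat s)" by (simp add: V_mem[OF x] r_def)
      then show "x \<in> (\<Union>n. V n)" by blast
    qed
  qed (auto simp: V_def)
  obtain F where F: "\<And>n. closedin X (F n)" "\<And>n. F n \<subseteq> V n" "(\<Union>n. F n) = topspace X"
    and fin: "\<And>x. x \<in> topspace X \<Longrightarrow> \<exists>N. openin X N \<and> x \<in> N \<and> finite {n. F n \<inter> N \<noteq> {}}"
    using countably_paracompact_normal_closed_shrinking[OF cp X V_open V_cover] by metis
  have Fx: "finite {n. x \<in> F n}" if x: "x \<in> topspace X" for x
  proof -
    obtain N where "x \<in> N" "finite {n. F n \<inter> N \<noteq> {}}" using fin[OF x] by blast
    then show ?thesis by (auto elim: finite_subset[rotated])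
  qed
  have Fr: "a x < r n" "r n < b x" "r n \<notin> \<theta> x" if "x \<in> topspace X" "x \<in> F n" for x n
    using that F(2) V_mem by blast+
  define P where "P = (\<lambda>x. Min (insert (p x) (r ` {n. x \<in> F n})))"
  \<comment> \<open>A maximum written as a negated minimum, so that the lemma on locally finite
    minima serves for \<open>Q\<close> as well.\<close>
  define Q where "Q = (\<lambda>x. - Min (insert (- q x) ((\<lambda>n. - r n) ` {n. x \<in> F n})))"
  have P_lsc: "lower_semicontinuous_real X P"
    unfolding P_def by (rule lower_semicontinuous_real_Min_locally_finite[OF p F(1) fin])
  have Q_usc: "upper_semicontinuous_real X Q"
    unfolding Q_def upper_semicontinuous_real_uminus
    by (rule lower_semicontinuous_real_Min_locally_finite[OF _ F(1) fin]) (use q in auto)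
  have PQ: "a x \<le> P x" "P x \<le> p x" "q x \<le> Q x" "Q x \<le> b x"
    and Fn: "\<And>n. x \<in> F n \<Longrightarrow> P x \<le> r n \<and> r n \<le> Q x" if x: "x \<in> topspace X" for x
  proof -
    note fin' = Fx[OF x]
    show "a x \<le> P x"
      unfolding P_def using fin' bounds[OF x] Fr[OF x] by (auto simp: less_imp_le)
    show "P x \<le> p x" unfolding P_def using fin' by simp
    have "- b x \<le> Min (insert (- q x) ((\<lambda>n. - r n) ` {n. x \<in> F n}))"
      using fin' bounds[OF x] Fr[OF x] by (auto simp: less_imp_le)
    then show "Q x \<le> b x" unfolding Q_def by linarith
    have "Min (insert (- q x) ((\<lambda>n. - r n) ` {n. x \<in> F n})) \<le> - q x" using fin' by simp
    then show "q x \<le> Q x" unfolding Q_def by linarith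
    fix n assume n: "x \<in> F n"
    have "P x \<le> r n" unfolding P_def using fin' n by (intro Min_le) auto
    moreover have "Min (insert (- q x) ((\<lambda>n. - r n) ` {n. x \<in> F n})) \<le> - r n"
      using fin' n by (intro Min_le) auto
    ultimately show "P x \<le> r n \<and> r n \<le> Q x" unfolding Q_def by linarith
  qed
  obtain g where g: "continuous_map X euclideanreal g"
    "\<And>x. x \<in> topspace X \<Longrightarrow> a x \<le> g x \<and> g x \<le> P x"
  proof (rule Katetov_Tong_insertion[OF X a P_lsc])
    fix x assume "x \<in> topspace X"
    with PQ[of x] bounds[of x] \<Phi>x[of x] show "l \<le> a x \<and> a x \<le> P x \<and> P x \<le> u" by linarith
  qed blast
  obtain h where h: "continuous_map X euclideanreal h"
    "\<And>x. x \<in> topspace X \<Longrightarrow> Q x \<le> h x \<and> h x \<le> b x"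
  proof (rule Katetov_Tong_insertion[OF X Q_usc b])
    fix x assume "x \<in> topspace X"
    with PQ[of x] bounds[of x] \<Phi>x[of x] show "l \<le> Q x \<and> Q x \<le> b x \<and> b x \<le> u" by linarith
  qed blast
  have gh: "l \<le> g x" "g x \<le> p x" "q x \<le> h x" "g x \<le> h x" "h x \<le> u" "a x \<le> g x" "h x \<le> b x"
    if "x \<in> topspace X" for x
    using g(2)[OF that] h(2)[OF that] PQ[OF that] bounds[OF that] \<Phi>x[OF that] by linarith+
  show "\<exists>\<phi>. \<phi> \<in> topspace X \<rightarrow> nonempty_compact_connected_sets ?K \<and>
      continuous_set_map X ?K \<phi> \<and> set_map_less X \<theta> \<phi> \<and> set_map_le X \<phi> \<Phi>"
  proof (intro exI[of _ "\<lambda>x. {g x..h x}"] conjI)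
    show "(\<lambda>x. {g x..h x}) \<in> topspace X \<rightarrow> nonempty_compact_connected_sets ?K"
      unfolding nonempty_compact_connected_sets_atLeastAtMost using gh by blast
    have "g x \<le> h x \<and> {g x..h x} \<subseteq> {l..u}" if "x \<in> topspace X" for x
      using gh[OF that] by auto
    then show "continuous_set_map X ?K (\<lambda>x. {g x..h x})"
      using g(1) h(1) unfolding continuous_set_map_def continuous_map_iff_semicontinuous
      by (intro conjI lsc_map_atLeastAtMost usc_map_atLeastAtMost) auto
    show "set_map_less X \<theta> (\<lambda>x. {g x..h x})"
      unfolding set_map_less_def set_map_le_def
    proof (intro conjI ballI)
      fix x assume x: "x \<in> topspace X"
      show "\<theta> x \<subseteq> {g x..h x}"
        using bounds(4)[OF x] gh(2,3)[OF x] by fastforce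
      obtain n where n: "x \<in> F n" using F(3) x by blast
      then have "r n \<in> {g x..h x}"
        using Fn[OF x n] g(2)[OF x] h(2)[OF x] by auto
      with Fr(3)[OF x n] show "{g x..h x} - \<theta> x \<noteq> {}" by blast
    qed
    show "set_map_le X (\<lambda>x. {g x..h x}) \<Phi>"
      unfolding set_map_le_def using \<Phi>x(1) gh(6,7) by auto
  qed
qed

section \<open>Strict insertion\<close>

text \<open>With the left end \<open>l\<close> shared, an expansion can gain points only on the
  right, so its supremum exceeds \<open>\<xi>\<close>. That supremum is continuous because the
  expansion is both l.s.c. and u.s.c.\<close>

lemma set_expansion_property_insertion:
  fixes \<xi> \<eta> :: "'a \<Rightarrow> real"
  assumes X: "set_expansion_property X (top_of_set {l..u::real})"
    and \<xi>: "upper_semicontinuous_real X \<xi>" and \<eta>: "lower_semicontinuous_real X \<eta>"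
    and less: "\<And>x. x \<in> topspace X \<Longrightarrow> l \<le> \<xi> x \<and> \<xi> x < \<eta> x \<and> \<eta> x \<le> u"
  obtains h where "continuous_map X euclideanreal h"
    "\<And>x. x \<in> topspace X \<Longrightarrow> \<xi> x < h x \<and> h x \<le> \<eta> x"
proof -
  let ?K = "top_of_set {l..u}"
  have "(\<lambda>x. {l..\<eta> x}) \<in> topspace X \<rightarrow> nonempty_closed_connected_sets ?K"
  proof
    fix x assume "x \<in> topspace X"
    with less have "l \<le> \<eta> x" "\<eta> x \<le> u" by fastforce+
    then show "{l..\<eta> x} \<in> nonempty_closed_connected_sets ?K"
      unfolding nonempty_closed_connected_sets_atLeastAtMost by blast
  qed
  moreover have "lsc_map X ?K (\<lambda>x. {l..\<eta> x})"
    by (rule lsc_map_atLeastAtMost[OF semicontinuous_real_const(2) \<eta>]) (use less in force)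
  moreover have "(\<lambda>x. {l..\<xi> x}) \<in> topspace X \<rightarrow> nonempty_compact_sets ?K"
    unfolding nonempty_compact_sets_atLeastAtMost using less by force
  moreover have "usc_map X ?K (\<lambda>x. {l..\<xi> x})"
    by (rule usc_map_atLeastAtMost[OF semicontinuous_real_const(1) \<xi>]) (use less in force)
  moreover have "set_map_less X (\<lambda>x. {l..\<xi> x}) (\<lambda>x. {l..\<eta> x})"
    unfolding set_map_less_def set_map_le_def
  proof (intro conjI ballI)
    fix x assume x: "x \<in> topspace X"
    show "{l..\<xi> x} \<subseteq> {l..\<eta> x}" using less[OF x] by auto
    have "\<eta> x \<in> {l..\<eta> x} - {l..\<xi> x}" using less[OF x] by auto
    then show "{l..\<eta> x} - {l..\<xi> x} \<noteq> {}" by blast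
  qed
  ultimately obtain \<phi> where \<phi>: "\<phi> \<in> topspace X \<rightarrow> nonempty_compact_connected_sets ?K"
    "lsc_map X ?K \<phi>" "usc_map X ?K \<phi>"
    "set_map_less X (\<lambda>x. {l..\<xi> x}) \<phi>" "set_map_le X \<phi> (\<lambda>x. {l..\<eta> x})"
    using X unfolding set_expansion_property_def continuous_set_map_def by metis
  define h where "h = (\<lambda>x. Sup (\<phi> x))"
  have \<phi>x: "\<phi> x \<subseteq> {l..u}" "\<phi> x \<noteq> {}" "compact (\<phi> x)" "\<xi> x < h x" "h x \<le> \<eta> x"
    if x: "x \<in> topspace X" for x
  proof -
    have "\<phi> x \<in> nonempty_compact_connected_sets ?K" using \<phi>(1) x by blast
    then obtain s t where st: "\<phi> x = {s..t}" "l \<le> s" "s \<le> t" "t \<le> u"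
      unfolding nonempty_compact_connected_sets_atLeastAtMost by blast
    then show "\<phi> x \<subseteq> {l..u}" "\<phi> x \<noteq> {}" "compact (\<phi> x)" by auto
    have h: "h x = t" using st by (simp add: h_def)
    have "{s..t} \<subseteq> {l..\<eta> x}" using \<phi>(5) x st(1) unfolding set_map_le_def by auto
    with st h show "h x \<le> \<eta> x" by auto
    have "\<not> {s..t} \<subseteq> {l..\<xi> x}" using \<phi>(4) x st(1) unfolding set_map_less_def by auto
    with st h show "\<xi> x < h x" by force
  qed
  have "lower_semicontinuous_real X h"
    unfolding h_def
    by (rule lsc_map_Sup[OF \<phi>(2)]) (meson \<phi>x bdd_above_Icc bdd_above_mono)
  moreover have "upper_semicontinuous_real X h"
    unfolding h_def by (rule usc_map_Sup[OF \<phi>(3)]) (use \<phi>x in auto)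
  ultimately show thesis
    using that[of h] \<phi>x(4,5) by (simp add: continuous_map_iff_semicontinuous)
qed

text \<open>Each sublevel set of the composition is everything, empty, or the sublevel set of
  \<open>f\<close> at \<open>tan r\<close>. This brings unbounded functions into a bounded
  interval.\<close>

lemma upper_semicontinuous_real_arctan:
  assumes "upper_semicontinuous_real X f"
  shows "upper_semicontinuous_real X (\<lambda>x. arctan (f x))"
  unfolding upper_semicontinuous_real_def
proof
  fix r
  consider "pi / 2 \<le> r" | "r \<le> - (pi / 2)" | "- (pi / 2) < r" "r < pi / 2" by linarith
  then show "openin X {x \<in> topspace X. arctan (f x) < r}"
  proof cases
    case 1
    then have "arctan (f x) < r" for x using arctan_ubound[of "f x"] by linarith
    then show ?thesis by simp
  next
    case 2
    then have "\<not> arctan (f x) < r" for x using arctan_lbound[of "f x"] by linarith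
    then show ?thesis by simp
  next
    case 3
    then have "arctan (tan r) = r" by (simp add: arctan_tan)
    then have "arctan (f x) < r \<longleftrightarrow> f x < tan r" for x by (metis arctan_less_iff)
    then show ?thesis using assms by (simp add: upper_semicontinuous_real_def)
  qed
qed

lemma lower_semicontinuous_real_arctan:
  assumes "lower_semicontinuous_real X f"
  shows "lower_semicontinuous_real X (\<lambda>x. arctan (f x))"
  using upper_semicontinuous_real_arctan[of X "\<lambda>x. - f x"] assms by (simp add: arctan_minus)

lemma set_expansion_property_imp_strict_insertion_property:
  assumes X: "set_expansion_property X (top_of_set {- (pi / 2)..pi / 2})"
  shows "strict_insertion_property X"
  unfolding strict_insertion_property_def
proof (intro allI impI, elim conjE)
  fix \<xi> \<eta> :: "'a \<Rightarrow> real"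
  assume "upper_semicontinuous_real X \<xi>" "lower_semicontinuous_real X \<eta>"
    and less: "\<forall>x\<in>topspace X. \<xi> x < \<eta> x"
  then have \<xi>: "upper_semicontinuous_real X (\<lambda>x. arctan (\<xi> x))"
    and \<eta>: "lower_semicontinuous_real X (\<lambda>x. arctan (\<eta> x))"
    by (simp_all add: upper_semicontinuous_real_arctan lower_semicontinuous_real_arctan)
  have bounds: "- (pi / 2) < arctan (\<xi> x)" "arctan (\<xi> x) < arctan (\<eta> x)" "arctan (\<eta> x) < pi / 2"
    if "x \<in> topspace X" for x
    using less that arctan_lbound[of "\<xi> x"] arctan_ubound[of "\<eta> x"] by (auto simp: arctan_less_iff)
  obtain h where h: "continuous_map X euclideanreal h"
    "\<And>x. x \<in> topspace X \<Longrightarrow> arctan (\<xi> x) < h x \<and> h x \<le> arctan (\<eta> x)"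
  proof (rule set_expansion_property_insertion[OF X \<xi> \<eta>])
    show "- (pi / 2) \<le> arctan (\<xi> x) \<and> arctan (\<xi> x) < arctan (\<eta> x) \<and> arctan (\<eta> x) \<le> pi / 2"
      if "x \<in> topspace X" for x
      using bounds[OF that] by linarith
  qed blast
  \<comment> \<open>Applied to the negated pair in reverse order: \<open>- g\<close> lies weakly
    above \<open>arctan (\<xi> x)\<close> and strictly below
    \<open>arctan (\<eta> x)\<close>.\<close>
  obtain g where g: "continuous_map X euclideanreal g"
    "\<And>x. x \<in> topspace X \<Longrightarrow> - arctan (\<eta> x) < g x \<and> g x \<le> - arctan (\<xi> x)"
  proof (rule set_expansion_property_insertion[OF X, of "\<lambda>x. - arctan (\<eta> x)" "\<lambda>x. - arctan (\<xi> x)"])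
    show "- (pi / 2) \<le> - arctan (\<eta> x) \<and> - arctan (\<eta> x) < - arctan (\<xi> x) \<and> - arctan (\<xi> x) \<le> pi / 2"
      if "x \<in> topspace X" for x
      using bounds[OF that] by linarith
    show "upper_semicontinuous_real X (\<lambda>x. - arctan (\<eta> x))"
      "lower_semicontinuous_real X (\<lambda>x. - arctan (\<xi> x))"
      using \<xi> \<eta> by simp_all
  qed blast
  \<comment> \<open>The mean of \<open>h\<close> and \<open>- g\<close>: the first makes the lower
    inequality strict, the second the upper one.\<close>
  define k where "k = (\<lambda>x. (h x - g x) / 2)"
  have k: "arctan (\<xi> x) < k x" "k x < arctan (\<eta> x)" if "x \<in> topspace X" for x
    using g(2)[OF that] h(2)[OF that] by (simp_all add: k_def)
  have "continuous_map X euclideanreal k"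
    unfolding k_def using g(1) h(1)
    by (intro continuous_map_real_divide continuous_map_diff continuous_map_const[THEN iffD2]) auto
  \<comment> \<open>Strictness keeps \<open>k\<close> off the ends of the interval, where
    \<open>tan\<close> could not be applied continuously.\<close>
  then have "continuous_map X (top_of_set {- (pi / 2)<..<pi / 2}) k"
    using k bounds by (fastforce simp: continuous_map_in_subtopology)
  moreover have "continuous_map (top_of_set {- (pi / 2)<..<pi / 2}) euclideanreal tan"
  proof -
    have "cos x \<noteq> 0" if "x \<in> {- (pi / 2)<..<pi / 2}" for x :: real
      using that cos_gt_zero_pi[of x] by simp
    then show ?thesis by (auto intro!: continuous_intros)
  qed
  ultimately have "continuous_map X euclideanreal (tan \<circ> k)"
    by (rule continuous_map_compose)
  moreover have "\<xi> x < tan (k x) \<and> tan (k x) < \<eta> x" if x: "x \<in> topspace X" for x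
  proof -
    have "arctan (tan (k x)) = k x"
      using k[OF x] bounds[OF x] by (intro arctan_tan) auto
    with k[OF x] show ?thesis by (metis arctan_less_iff)
  qed
  ultimately show "\<exists>f. continuous_map X euclideanreal f \<and>
      (\<forall>x\<in>topspace X. \<xi> x < f x \<and> f x < \<eta> x)"
    by (intro exI[of _ "tan \<circ> k"]) simp
qed

section \<open>From strict insertion back to normality and countable paracompactness\<close>

lemma upper_semicontinuous_real_indicator:
  assumes "closedin X S"
  shows "upper_semicontinuous_real X (indicator S)"
  unfolding upper_semicontinuous_real_def
proof
  fix r :: real
  have "{x \<in> topspace X. indicator S x < r} =
      (if 1 < r then topspace X else if 0 < r then topspace X - S else {})"
    by (auto simp: indicator_def)
  then show "openin X {x \<in> topspace X. indicator S x < r}" using assms by auto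
qed

text \<open>A function inserted between \<open>indicator S\<close> and
  \<open>2 - indicator T\<close> is above 1 on \<open>S\<close> and below 1 on \<open>T\<close>, so
  the level 1 separates them. The constant 2 leaves room above \<open>indicator S\<close> off
  \<open>T\<close>.\<close>

lemma strict_insertion_property_imp_normal_space:
  assumes X: "strict_insertion_property X"
  shows "normal_space X"
  unfolding normal_space_def
proof (intro allI impI, elim conjE)
  fix S T assume S: "closedin X S" and T: "closedin X T" and ST: "disjnt S T"
  have "lower_semicontinuous_real X (\<lambda>x. 2 - indicator T x)"
    unfolding lower_semicontinuous_real_def
  proof
    fix r :: real
    have "{x \<in> topspace X. r < 2 - indicator T x} = {x \<in> topspace X. indicator T x < 2 - r}"
      by auto
    then show "openin X {x \<in> topspace X. r < 2 - indicator T x}"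
      using upper_semicontinuous_real_indicator[OF T] by (simp add: upper_semicontinuous_real_def)
  qed
  moreover have "indicator S x < (2 - indicator T x :: real)" for x
    using ST by (auto simp: indicator_def disjnt_iff)
  ultimately obtain f where f: "continuous_map X euclideanreal f"
    "\<And>x. x \<in> topspace X \<Longrightarrow> indicator S x < f x \<and> f x < 2 - indicator T x"
    using X upper_semicontinuous_real_indicator[OF S] unfolding strict_insertion_property_def
    by metis
  have "openin X {x \<in> topspace X. f x > 1}" "openin X {x \<in> topspace X. f x < 1}"
    using f(1) by (simp_all add: continuous_map_upper_lower_semicontinuous_lt)
  moreover have "S \<subseteq> {x \<in> topspace X. f x > 1}" "T \<subseteq> {x \<in> topspace X. f x < 1}"
    using f(2) closedin_subset[OF S] closedin_subset[OF T] by (fastforce simp: indicator_def)+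
  moreover have "disjnt {x \<in> topspace X. f x > 1} {x \<in> topspace X. f x < 1}"
    by (auto simp: disjnt_iff)
  ultimately show "\<exists>U V. openin X U \<and> openin X V \<and> S \<subseteq> U \<and> T \<subseteq> V \<and> disjnt U V"
    by blast
qed

text \<open>A continuous positive \<open>f\<close> below \<open>\<eta>\<close> is used to cut each
  \<open>U n\<close> down to the points with \<open>f x < 1 / (n + 1)\<close>. The first cover
  element containing a point keeps it, while near any point \<open>f\<close> stays above some
  \<open>1 / (m + 1)\<close>, so only the sets with index below \<open>m\<close> can meet that
  neighbourhood.\<close>

lemma strict_insertion_property_imp_countably_paracompact_space:
  assumes X: "strict_insertion_property X"
  shows "countably_paracompact_space X"
  unfolding countably_paracompact_space_def
proof (intro allI impI, elim conjE)
  fix \<U> assume cnt: "countable \<U>" and \<U>: "open_cover X \<U>"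
  show "\<exists>\<V>. open_cover X \<V> \<and> refines \<V> \<U> \<and> locally_finite_in X \<V>"
  proof (cases "\<U> = {}")
    case True
    with \<U> show ?thesis
      by (intro exI[of _ "{}"]) (auto simp: refines_def locally_finite_in_def open_cover_def)
  next
    case False
    \<comment> \<open>For a finite cover this enumeration repeats members; it needs the cover to be
      nonempty, hence the case split.\<close>
    define U where "U = from_nat_into \<U>"
    have rangeU: "range U = \<U>" unfolding U_def using False cnt by (rule range_from_nat_into)
    then have U_open: "openin X (U n)" for n using \<U> unfolding open_cover_def by blast
    have U_cover: "\<exists>n. x \<in> U n" if "x \<in> topspace X" for x
      using \<U> that rangeU unfolding open_cover_def by blast
    define \<nu> where "\<nu> = (\<lambda>x. LEAST n. x \<in> U n)"
    have \<nu>: "x \<in> U (\<nu> x)" if "x \<in> topspace X" for x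
      unfolding \<nu>_def using U_cover[OF that] by (rule LeastI_ex)
    define \<eta> where "\<eta> = (\<lambda>x. 1 / (real (\<nu> x) + 1))"
    have "lower_semicontinuous_real X \<eta>"
      unfolding lower_semicontinuous_real_def
    proof
      fix r
      \<comment> \<open>Any index \<open>n\<close> with \<open>x \<in> U n\<close> bounds
        \<open>\<nu> x\<close> from above and so \<open>\<eta> x\<close> from below; the least such
        index attains the bound.\<close>
      have "{x \<in> topspace X. \<eta> x > r} = (\<Union>n\<in>{n. 1 / (real n + 1) > r}. U n)"
      proof (intro set_eqI iffI)
        fix x assume "x \<in> {x \<in> topspace X. \<eta> x > r}"
        then show "x \<in> (\<Union>n\<in>{n. 1 / (real n + 1) > r}. U n)"
          using \<nu>[of x] by (auto simp: \<eta>_def)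
      next
        fix x assume "x \<in> (\<Union>n\<in>{n. 1 / (real n + 1) > r}. U n)"
        then obtain n where n: "r < 1 / (real n + 1)" "x \<in> U n" by auto
        have "\<nu> x \<le> n" unfolding \<nu>_def using n(2) by (rule Least_le)
        then have "1 / (real n + 1) \<le> \<eta> x" by (simp add: \<eta>_def frac_le)
        with n U_open[of n] show "x \<in> {x \<in> topspace X. \<eta> x > r}"
          using openin_subset by fastforce
      qed
      moreover have "openin X (\<Union>n\<in>{n. 1 / (real n + 1) > r}. U n)" using U_open by blast
      ultimately show "openin X {x \<in> topspace X. \<eta> x > r}" by simp
    qed
    moreover have "0 < \<eta> x" for x by (simp add: \<eta>_def)
    ultimately obtain f where f: "continuous_map X euclideanreal f"
      "\<And>x. x \<in> topspace X \<Longrightarrow> 0 < f x \<and> f x < \<eta> x"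
      using X semicontinuous_real_const(2)[of X 0] unfolding strict_insertion_property_def by metis
    have f_open: "openin X {x \<in> topspace X. f x > r}" "openin X {x \<in> topspace X. f x < r}" for r
      using f(1) by (simp_all add: continuous_map_upper_lower_semicontinuous_lt)
    define W where "W = (\<lambda>n. U n \<inter> {x \<in> topspace X. f x < 1 / (real n + 1)})"
    have "\<forall>V\<in>range W. openin X V" unfolding W_def using U_open f_open by blast
    moreover have "\<Union>(range W) = topspace X"
    proof
      show "topspace X \<subseteq> \<Union>(range W)"
      proof
        fix x assume x: "x \<in> topspace X"
        then have "x \<in> W (\<nu> x)" using \<nu> f(2) by (simp add: W_def \<eta>_def)
        then show "x \<in> \<Union>(range W)" by blast
      qed
    qed (auto simp: W_def)
    moreover have "refines (range W) \<U>"
      unfolding refines_def W_def using rangeU by blast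
    moreover have "locally_finite_in X (range W)"
      unfolding locally_finite_in_def
    proof (intro conjI ballI)
      show "\<Union>(range W) \<subseteq> topspace X" by (auto simp: W_def)
      fix x assume x: "x \<in> topspace X"
      obtain m where m: "1 / (real m + 1) < f x"
        using reals_Archimedean[of "f x"] f(2)[OF x] by (auto simp: inverse_eq_divide add.commute)
      let ?N = "{y \<in> topspace X. f y > 1 / (real m + 1)}"
      have "W n \<inter> ?N = {}" if "m \<le> n" for n
      proof -
        have "1 / (real n + 1) \<le> 1 / (real m + 1)" using that by (simp add: frac_le)
        then show ?thesis by (force simp: W_def)
      qed
      then have "n < m" if "W n \<inter> ?N \<noteq> {}" for n
        using that by (meson not_le)
      then have "{V \<in> range W. V \<inter> ?N \<noteq> {}} \<subseteq> W ` {..<m}"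
        by blast
      then have "finite {V \<in> range W. V \<inter> ?N \<noteq> {}}"
        using finite_subset by blast
      then show "\<exists>N. openin X N \<and> x \<in> N \<and> finite {V \<in> range W. V \<inter> N \<noteq> {}}"
        using f_open(1) x m by (intro exI[of _ ?N]) auto
    qed
    ultimately show ?thesis unfolding open_cover_def by blast
  qed
qed

theorem lemma3p4:
  fixes X :: "'a topology" and A :: "'b set"
  assumes "Hausdorff_space X" and "infinite (topspace X)" and "card A = 2"
  shows
    "let J = hedgehog_topology A;
         cond_a = (countably_paracompact_space X \<and> normal_space X);
         cond_b = (\<forall>\<Phi> \<theta>.
           \<Phi> \<in> topspace X \<rightarrow> nonempty_closed_connected_sets J \<and> lsc_map X J \<Phi> \<and>
           \<theta> \<in> topspace X \<rightarrow> nonempty_compact_sets J \<and> usc_map X J \<theta> \<and>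
           set_map_less X \<theta> \<Phi> \<longrightarrow>
           (\<exists>\<phi>. \<phi> \<in> topspace X \<rightarrow> nonempty_compact_connected_sets J \<and>
                continuous_set_map X J \<phi> \<and> set_map_less X \<theta> \<phi> \<and> set_map_le X \<phi> \<Phi>));
         cond_c = (\<forall>\<xi> \<eta>.
           upper_semicontinuous_real X \<xi> \<and> lower_semicontinuous_real X \<eta> \<and>
           (\<forall>x\<in>topspace X. \<xi> x < \<eta> x) \<longrightarrow>
           (\<exists>f. continuous_map X euclideanreal f \<and>
                (\<forall>x\<in>topspace X. \<xi> x < f x \<and> f x < \<eta> x)))
     in (cond_a \<longleftrightarrow> cond_b) \<and> (cond_b \<longleftrightarrow> cond_c)"
proof -
  \<comment> \<open>Bridges the interval model of the hedgehog and the closure of the range of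
    \<open>arctan\<close>, where the insertion argument takes place.\<close>
  have "(top_of_set {-1..1::real}) homeomorphic_space (top_of_set {- (pi / 2)..pi / 2})"
    using homeomorphic_closed_intervals_real[of "-1" 1 "- (pi / 2)" "pi / 2"]
    unfolding homeomorphic_def homeomorphism_def homeomorphic_space_def homeomorphic_maps_def
    by fastforce
  then have J: "set_expansion_property X (hedgehog_topology A) \<longleftrightarrow>
      set_expansion_property X (top_of_set {- (pi / 2)..pi / 2})"
    using hedgehog_topology_two_homeomorphic[OF assms(3)]
      homeomorphic_space_set_expansion_property homeomorphic_space_trans by blast
  have ab: "set_expansion_property X (hedgehog_topology A)"
    if "countably_paracompact_space X \<and> normal_space X"
    using that countably_paracompact_normal_imp_set_expansion_property J by blast
  have bc: "strict_insertion_property X" if "set_expansion_property X (hedgehog_topology A)"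
    using that set_expansion_property_imp_strict_insertion_property J by blast
  have ca: "countably_paracompact_space X \<and> normal_space X" if "strict_insertion_property X"
    using that strict_insertion_property_imp_normal_space
      strict_insertion_property_imp_countably_paracompact_space by blast
  show ?thesis
    \<comment> \<open>Folding conditions (b) and (c) into the named properties leaves the cycle (a)
      to (b) to (c) to (a).\<close>
    unfolding Let_def set_expansion_property_def[symmetric] strict_insertion_property_def[symmetric]
    using ab bc ca by blast
qed

end
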